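(* Let $p,r$ be real numbers. The family $\mathrm{TDC}\cap\mathrm{OSC}^{\mathrm E}_1(p,r)$ is nonempty if and only if $p,r\in(0,1)$ and there exist positive integers $\lambda_1,\lambda_2,\dots,\lambda_N$ (not necessarily distinct) with $\gcd(\lambda_1,\dots,\lambda_N)=1$ such that $p^{\lambda_1}+p^{\lambda_2}+\dots+p^{\lambda_N}=1$.
   Context: An IFS is a finite family $\mathcal S=\{S_1,\dots,S_N\}$, $N\ge2$, of contracting similarities of a Euclidean space $\mathbb R^d$ ($d\ge 1$ arbitrary), where $S_i$ has ratio $r_i\in(0,1)$, i.e. $|S_i(x)-S_i(y)|=r_i|x-y|$. $E_{\mathcal S}$ is the unique nonempty compact set with $E_{\mathcal S}=\bigcup_i S_i(E_{\mathcal S})$. $\mathcal S$ satisfies the open set condition (OSC) if there is a nonempty bounded open set $O$ such that the sets $S_i(O)$ are pairwise disjoint and contained in $O$. The ratios are commensurable if there is $r_{\mathcal S}\in(0,1)$ (the ratio root) with $r_i=r_{\mathcal S}^{\lambda_i}$ for positive integers $\lambda_i$ with $\gcd(\lambda_1,\dots,\lambda_N)=1$. $\mathrm{TDC}\cap\mathrm{OSC}^{\mathrm E}_1$ denotes the set of IFSs on Euclidean spaces that satisfy the OSC, have commensurable ratios, and whose $E_{\mathcal S}$ is totally disconnected. For such $\mathcal S$, with $s=\dim_H E_{\mathcal S}$ (equivalently $\sum_i r_i^s=1$), the measure root is $p_{\mathcal S}=r_{\mathcal S}^s$. $\mathrm{TDC}\cap\mathrm{OSC}^{\mathrm E}_1(p,r)$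 is the set of $\mathcal S\in\mathrm{TDC}\cap\mathrm{OSC}^{\mathrm E}_1$ with $p_{\mathcal S}=p$ and $r_{\mathcal S}=r$. *)

theory Defs
  imports "HOL-Analysis.Analysis"
begin

text \<open>
  The dimension of the ambient space varies inside the statement, so it cannot be a type.
  As in \<^const>\<open>Euclidean_space\<close>, the points of \<open>\<real>\<^sup>d\<close> are the functions \<open>nat \<Rightarrow> real\<close> that
  vanish from index \<open>d\<close> on; here they carry the Euclidean metric. The type \<open>nat \<Rightarrow> real\<close> also
  has a \<^class>\<open>metric_space\<close> instance, whose distance is a different one and is not used.
\<close>

definition euclid :: "nat \<Rightarrow> (nat \<Rightarrow> real) metric" where
  "euclid d = metric (topspace (Euclidean_space d), \<lambda>x y. L2_set (\<lambda>i. x i - y i) {..<d})"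

lemma Metric_space_euclid:
  "Metric_space (topspace (Euclidean_space d)) (\<lambda>x y. L2_set (\<lambda>i. x i - y i) {..<d})"
proof
  fix x y z :: "nat \<Rightarrow> real"
  show "0 \<le> L2_set (\<lambda>i. x i - y i) {..<d}"
    by simp
  show "L2_set (\<lambda>i. x i - y i) {..<d} = L2_set (\<lambda>i. y i - x i) {..<d}"
    by (simp add: L2_set_def power2_commute)
  show "L2_set (\<lambda>i. x i - z i) {..<d}
      \<le> L2_set (\<lambda>i. x i - y i) {..<d} + L2_set (\<lambda>i. y i - z i) {..<d}"
    using L2_set_triangle_ineq[of "\<lambda>i. x i - y i" "\<lambda>i. y i - z i" "{..<d}"] by simp
  assume "x \<in> topspace (Euclidean_space d)" "y \<in> topspace (Euclidean_space d)"
  then have "\<forall>i\<ge>d. x i = y i"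
    by (simp add: topspace_Euclidean_space)
  then show "L2_set (\<lambda>i. x i - y i) {..<d} = 0 \<longleftrightarrow> x = y"
    by (auto simp: L2_set_eq_0_iff fun_eq_iff) (metis lessThan_iff not_le)
qed

lemma mspace_euclid [simp]: "mspace (euclid d) = {x. \<forall>i\<ge>d. x i = 0}"
  unfolding euclid_def Metric_space.mspace_metric[OF Metric_space_euclid]
  by (simp add: topspace_Euclidean_space)

lemma mdist_euclid: "mdist (euclid d) x y = L2_set (\<lambda>i. x i - y i) {..<d}"
  unfolding euclid_def Metric_space.mdist_metric[OF Metric_space_euclid] ..

definition mdiameter :: "'a metric \<Rightarrow> 'a set \<Rightarrow> real" where
  "mdiameter m U = (if U = {} then 0 else SUP (x, y)\<in>U \<times> U. mdist m x y)"

definition hausdorff_content :: "'a metric \<Rightarrow> real \<Rightarrow> real \<Rightarrow> 'a set \<Rightarrow> ennreal" where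
  "hausdorff_content m s \<delta> A =
    (INF U \<in> {U :: nat \<Rightarrow> 'a set. A \<subseteq> (\<Union>n. U n) \<and>
        (\<forall>n. U n \<subseteq> mspace m \<and> (\<forall>x\<in>U n. \<forall>y\<in>U n. mdist m x y \<le> \<delta>))}.
      \<Sum>n. ennreal (mdiameter m (U n) powr s))"

definition hausdorff_measure :: "'a metric \<Rightarrow> real \<Rightarrow> 'a set \<Rightarrow> ennreal" where
  "hausdorff_measure m s A = (SUP \<delta>\<in>{0<..}. hausdorff_content m s \<delta> A)"

text \<open>
  Only \<open>s > 0\<close> is used, which does not change the infimum: \<open>0 powr 0 = 0\<close>, so
  \<^const>\<open>hausdorff_measure\<close> at \<open>s = 0\<close> is not the counting measure.
\<close>

definition hausdorff_dim :: "'a metric \<Rightarrow> 'a set \<Rightarrow> ereal" where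
  "hausdorff_dim m A = (INF s\<in>{s. 0 < s \<and> hausdorff_measure m s A = 0}. ereal s)"

definition mtotally_disconnected :: "'a metric \<Rightarrow> 'a set \<Rightarrow> bool" where
  "mtotally_disconnected m A \<longleftrightarrow>
    (\<forall>C. connectedin (mtopology_of m) C \<and> C \<subseteq> A \<longrightarrow> (\<exists>a. C \<subseteq> {a}))"

definition contracting_similarity :: "'a metric \<Rightarrow> real \<Rightarrow> ('a \<Rightarrow> 'a) \<Rightarrow> bool" where
  "contracting_similarity m c f \<longleftrightarrow> 0 < c \<and> c < 1 \<and> f \<in> mspace m \<rightarrow> mspace m \<and>
    (\<forall>x\<in>mspace m. \<forall>y\<in>mspace m. mdist m (f x) (f y) = c * mdist m x y)"

definition IFS :: "'a metric \<Rightarrow> ('a \<Rightarrow> 'a) list \<Rightarrow> bool" where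
  "IFS m S \<longleftrightarrow> 2 \<le> length S \<and> (\<forall>f\<in>set S. \<exists>c. contracting_similarity m c f)"

definition attractor :: "'a metric \<Rightarrow> ('a \<Rightarrow> 'a) list \<Rightarrow> 'a set" where
  "attractor m S =
    (THE E. E \<noteq> {} \<and> compactin (mtopology_of m) E \<and> E = (\<Union>f\<in>set S. f ` E))"

definition open_set_condition :: "'a metric \<Rightarrow> ('a \<Rightarrow> 'a) list \<Rightarrow> bool" where
  "open_set_condition m S \<longleftrightarrow>
    (\<exists>V. V \<noteq> {} \<and> openin (mtopology_of m) V \<and> Metric_space.mbounded (mspace m) (mdist m) V \<and>
      (\<forall>i<length S. (S ! i) ` V \<subseteq> V) \<and>
      (\<forall>i<length S. \<forall>j<length S. i \<noteq> j \<longrightarrow> disjnt ((S ! i) ` V) ((S ! j) ` V)))"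

definition is_ratio_root :: "'a metric \<Rightarrow> ('a \<Rightarrow> 'a) list \<Rightarrow> real \<Rightarrow> bool" where
  "is_ratio_root m S r \<longleftrightarrow> 0 < r \<and> r < 1 \<and>
    (\<exists>l :: nat \<Rightarrow> nat.
      (\<forall>i<length S. 0 < l i \<and> contracting_similarity m (r ^ l i) (S ! i)) \<and>
      Gcd (l ` {..<length S}) = 1)"

definition commensurable :: "'a metric \<Rightarrow> ('a \<Rightarrow> 'a) list \<Rightarrow> bool" where
  "commensurable m S \<longleftrightarrow> (\<exists>r. is_ratio_root m S r)"

definition ratio_root :: "'a metric \<Rightarrow> ('a \<Rightarrow> 'a) list \<Rightarrow> real" where
  "ratio_root m S = (THE r. is_ratio_root m S r)"

definition measure_root :: "'a metric \<Rightarrow> ('a \<Rightarrow> 'a) list \<Rightarrow> real" where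
  "measure_root m S = ratio_root m S powr real_of_ereal (hausdorff_dim m (attractor m S))"

text \<open>
  An IFS on a Euclidean space is a pair of the dimension and the list of its maps. The values of
  the maps outside \<open>\<real>\<^sup>d\<close> are irrelevant.
\<close>

definition TDC_OSC1E :: "(nat \<times> ((nat \<Rightarrow> real) \<Rightarrow> (nat \<Rightarrow> real)) list) set" where
  "TDC_OSC1E = {(d, S). 1 \<le> d \<and> IFS (euclid d) S \<and> open_set_condition (euclid d) S \<and>
    commensurable (euclid d) S \<and> mtotally_disconnected (euclid d) (attractor (euclid d) S)}"

definition TDC_OSC1E_roots ::
    "real \<Rightarrow> real \<Rightarrow> (nat \<times> ((nat \<Rightarrow> real) \<Rightarrow> (nat \<Rightarrow> real)) list) set" where
  "TDC_OSC1E_roots p r = {(d, S) \<in> TDC_OSC1E.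
    measure_root (euclid d) S = p \<and> ratio_root (euclid d) S = r}"

end

theory Submission
  imports Defs "HOL-Library.Sublist"
begin

text \<open>
  By Moran's theorem the Hausdorff dimension \<open>s\<close> of the attractor solves \<open>\<Sum>i. c i powr s = 1\<close>, where
  \<open>c i = r ^ l i\<close>; with \<open>p = r powr s\<close> this is \<open>\<Sum>i. p ^ l i = 1\<close>. The upper bound comes from the
  covers by the images under words of a fixed length. For the lower bound, a ball of radius \<open>\<rho>\<close> meets
  the images of the attractor under a bounded number of words of ratio about \<open>\<rho>\<close> (the open set
  condition separates them and the space is doubling); so a finite cover by balls yields a set of
  words that cuts every long word, and the sum of \<open>c powr s\<close> over such a set is at least \<open>1\<close>.

  Conversely, given \<open>r\<close> and the exponents, take \<open>d\<close> so large that \<open>2 N r^d < 1\<close>. The box with sides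
  \<open>1, r, \<dots>, r^(d - 1)\<close> is mapped by a rotation of ratio \<open>r\<close> into a slab of thickness \<open>r^d\<close>, so it has
  room for \<open>N\<close> images of ratios \<open>r ^ l i\<close> with gaps between them, which makes the attractor totally
  disconnected.
\<close>

section \<open>Euclidean spaces\<close>

text \<open>The packing form of the doubling property: the bound depends on the ratio
  \<open>\<kappa>\<close> of the two scales, not on the centre or on \<open>\<eta>\<close>. Both
  later applications count separated points directly.\<close>

definition doubling :: "'a metric \<Rightarrow> bool" where
  "doubling m \<longleftrightarrow> (\<forall>\<kappa>. \<exists>K::nat. \<forall>x \<eta> A. 0 < \<eta> \<and> A \<subseteq> mcball_of m x (\<kappa> * \<eta>) \<and>
     (\<forall>y\<in>A. \<forall>z\<in>A. y \<noteq> z \<longrightarrow> \<eta> \<le> mdist m y z) \<longrightarrow> finite A \<and> card A \<le> K)"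

lemma abs_le_mdist_euclid:
  assumes "i < d" shows "\<bar>x i - y i\<bar> \<le> mdist (euclid d) x y"
proof -
  have "L2_set (\<lambda>i. x i - y i) {..<d} = L2_set (\<lambda>i. \<bar>x i - y i\<bar>) {..<d}"
    by (simp add: L2_set_def)
  then show ?thesis
    using member_le_L2_set[of "{..<d}" i "\<lambda>i. \<bar>x i - y i\<bar>"] assms by (simp add: mdist_euclid)
qed

text \<open>The distance is at most the sum of the coordinate differences; the divisor
  \<open>Suc d\<close> makes the bound strict and is nonzero for \<open>d = 0\<close> as
  well.\<close>

lemma mdist_euclid_less:
  assumes "0 < e" "\<And>i. i < d \<Longrightarrow> \<bar>x i - y i\<bar> < e / real (Suc d)"
  shows "mdist (euclid d) x y < e"
proof -
  have "mdist (euclid d) x y \<le> (\<Sum>i<d. \<bar>x i - y i\<bar>)"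
    unfolding mdist_euclid by (rule L2_set_le_sum_abs)
  also have "\<dots> \<le> (\<Sum>i<d. e / real (Suc d))"
    using assms(2) by (intro sum_mono) (auto intro: less_imp_le)
  also have "\<dots> = e * (real d / real (Suc d))" by simp
  also have "\<dots> < e * 1"
    by (rule mult_strict_left_mono) (use assms(1) in \<open>simp_all add: divide_simps\<close>)
  finally show ?thesis by simp
qed

text \<open>Pigeonhole: cut the space into cubes of side \<open>\<eta> / Suc d\<close> with
  \<open>x\<close> as a corner. Two points of one cube are closer than \<open>\<eta>\<close>, so
  separated points lie in different cubes, and the number of cubes that can meet the ball depends
  only on \<open>\<kappa>\<close> and \<open>d\<close>.\<close>

lemma doubling_euclid: "doubling (euclid d)"
  unfolding doubling_def
proof
  fix \<kappa> :: real
  define L where "L = {\<lfloor>- (\<kappa> * real (Suc d))\<rfloor> .. \<lfloor>\<kappa> * real (Suc d)\<rfloor>}"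
  define K where "K = card ({..<d} \<rightarrow>\<^sub>E L)"
  have bound: "finite A \<and> card A \<le> K"
    if eta: "0 < \<eta>" and A: "A \<subseteq> mcball_of (euclid d) x (\<kappa> * \<eta>)"
      and sep: "\<forall>y\<in>A. \<forall>z\<in>A. y \<noteq> z \<longrightarrow> \<eta> \<le> mdist (euclid d) y z" for x \<eta> A
  proof -
    \<comment> \<open>The index of the cube that contains \<open>z\<close>, made extensional so that
      the indices range over a finite function space.\<close>
    define q where "q = (\<lambda>z::nat\<Rightarrow>real. \<lambda>i\<in>{..<d}. \<lfloor>(z i - x i) * real (Suc d) / \<eta>\<rfloor>)"
    have "q ` A \<subseteq> ({..<d} \<rightarrow>\<^sub>E L)"
    proof (clarsimp simp: q_def L_def)
      fix z i assume z: "z \<in> A" "i < d"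
      have "\<bar>x i - z i\<bar> \<le> \<kappa> * \<eta>"
        using abs_le_mdist_euclid[of i d x z] z A by fastforce
      then have *: "z i - x i \<le> \<kappa> * \<eta>" "- (\<kappa> * \<eta>) \<le> z i - x i" by auto
      have "(z i - x i) * real (Suc d) / \<eta> \<le> \<kappa> * real (Suc d)"
        using mult_right_mono[OF *(1), of "real (Suc d)"] eta by (simp only: divide_simps) (simp add: algebra_simps)
      moreover have "- (\<kappa> * real (Suc d)) \<le> (z i - x i) * real (Suc d) / \<eta>"
        using mult_right_mono[OF *(2), of "real (Suc d)"] eta by (simp only: divide_simps) (simp add: algebra_simps)
      ultimately show "\<lfloor>- (\<kappa> * (1 + real d))\<rfloor> \<le> \<lfloor>(z i - x i) * (1 + real d) / \<eta>\<rfloor> \<and> 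
        \<lfloor>(z i - x i) * (1 + real d) / \<eta>\<rfloor> \<le> \<lfloor>\<kappa> * (1 + real d)\<rfloor>"
        by (intro conjI floor_mono) simp_all
    qed
    moreover have "inj_on q A"
    proof (rule inj_onI, rule ccontr)
      fix y z assume yz: "y \<in> A" "z \<in> A" "q y = q z" "y \<noteq> z"
      have "\<bar>y i - z i\<bar> < \<eta> / real (Suc d)" if "i < d" for i
      proof -
        have "\<lfloor>(y i - x i) * real (Suc d) / \<eta>\<rfloor> = \<lfloor>(z i - x i) * real (Suc d) / \<eta>\<rfloor>"
          using fun_cong[OF yz(3), of i] that by (simp add: q_def)
        then have "\<bar>(y i - x i) * real (Suc d) / \<eta> - (z i - x i) * real (Suc d) / \<eta>\<bar> < 1"
          by linarith
        also have "(y i - x i) * real (Suc d) / \<eta> - (z i - x i) * real (Suc d) / \<eta>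
            = (y i - z i) * (real (Suc d) / \<eta>)"
          by (simp add: diff_divide_distrib[symmetric] left_diff_distrib[symmetric] del: of_nat_Suc)
        finally have "\<bar>y i - z i\<bar> * (real (Suc d) / \<eta>) < 1"
          using eta by (simp add: abs_mult)
        then show ?thesis using eta by (simp add: field_simps)
      qed
      then have "mdist (euclid d) y z < \<eta>" using eta by (intro mdist_euclid_less) auto
      with sep yz show False by fastforce
    qed
    moreover have "finite ({..<d} \<rightarrow>\<^sub>E L)" by (simp add: L_def finite_PiE)
    ultimately show ?thesis
      unfolding K_def using card_inj_on_le inj_on_finite by blast
  qed
  show "\<exists>K. \<forall>x \<eta> A. 0 < \<eta> \<and> A \<subseteq> mcball_of (euclid d) x (\<kappa> * \<eta>) \<and>
     (\<forall>y\<in>A. \<forall>z\<in>A. y \<noteq> z \<longrightarrow> \<eta> \<le> mdist (euclid d) y z) \<longrightarrow> finite A \<and> card A \<le> K"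
    by (intro exI[of _ K] allI impI) (elim conjE, rule bound)
qed

text \<open>Closeness in finitely many coordinates forces Euclidean closeness, so the product
  topology on the space is at least as fine as the metric one. This carries compactness of boxes
  over to the metric topology.\<close>

lemma continuous_map_id_euclid:
  "continuous_map (top_of_set (mspace (euclid d))) (mtopology_of (euclid d)) id"
proof -
  interpret Metric_space "mspace (euclid d)" "mdist (euclid d)" by (rule Metric_space_mspace_mdist)
  have "\<exists>U. openin (top_of_set (mspace (euclid d))) U \<and> x \<in> U \<and> (\<forall>y\<in>U. id y \<in> mball (id x) e)"
    if x: "x \<in> mspace (euclid d)" and e: "0 < e" for x e
  proof (intro exI conjI ballI)
    let ?B = "\<Inter>i<d. {y::nat\<Rightarrow>real. \<bar>x i - y i\<bar> < e / real (Suc d)}"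
    have "open ?B"
      by (intro open_INT finite_lessThan ballI open_Collect_less continuous_intros)
        (simp add: continuous_on_product_coordinates)
    then show "openin (top_of_set (mspace (euclid d))) (mspace (euclid d) \<inter> ?B)"
      by (rule openin_open_Int)
    show "x \<in> mspace (euclid d) \<inter> ?B" using x e by simp
    fix y assume "y \<in> mspace (euclid d) \<inter> ?B"
    with mdist_euclid_less[OF e, of d x y] x show "id y \<in> mball (id x) e"
      by (auto simp del: mspace_euclid)
  qed
  then show ?thesis
    unfolding mtopology_of_def continuous_map_to_metric by (simp del: mspace_euclid)
qed

text \<open>The ball is a closed subset of a box, and the box is compact by Tychonoff's
  theorem.\<close>

lemma compactin_euclid_mcball: "compactin (mtopology_of (euclid d)) (mcball_of (euclid d) x R)"
proof -
  interpret Metric_space "mspace (euclid d)" "mdist (euclid d)" by (rule Metric_space_mspace_mdist)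
  define B where "B = (\<lambda>i. if i < d then {x i - R .. x i + R} else {0})"
  have B: "compact (PiE UNIV B)"
  proof -
    have "compactin (powertop_real UNIV) (PiE UNIV B)"
      by (subst compactin_PiE) (auto simp: B_def)
    then show ?thesis by (simp add: euclidean_product_topology)
  qed
  have sub: "PiE UNIV B \<subseteq> mspace (euclid d)"
  proof
    fix y assume y: "y \<in> PiE UNIV B"
    have "y i = 0" if "d \<le> i" for i
      using PiE_mem[OF y, of i] that by (simp add: B_def)
    then show "y \<in> mspace (euclid d)" by simp
  qed
  have "compactin (top_of_set (mspace (euclid d))) (PiE UNIV B)"
    using B sub by (simp add: compactin_subtopology del: mspace_euclid)
  then have "compactin (mtopology_of (euclid d)) (id ` PiE UNIV B)"
    by (rule image_compactin[OF _ continuous_map_id_euclid])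
  moreover have "mcball_of (euclid d) x R \<subseteq> PiE UNIV B"
  proof
    fix y assume y: "y \<in> mcball_of (euclid d) x R"
    have "y i \<in> B i" for i
    proof (cases "i < d")
      case True
      then show ?thesis using y abs_le_mdist_euclid[OF True, of x y] by (auto simp: B_def)
    qed (use y in \<open>auto simp: B_def\<close>)
    then show "y \<in> PiE UNIV B" by (intro PiE_I) auto
  qed
  moreover have "closedin (mtopology_of (euclid d)) (mcball_of (euclid d) x R)"
    by (simp add: mtopology_of_def mcball_of_def del: mspace_euclid)
  ultimately show ?thesis
    using closed_compactin by (metis image_id id_apply)
qed

text \<open>A point at distance \<open>e\<close> from the compact image would have an \<open>e\<close>-separated infinite orbit.\<close>

lemma isometry_onto_mcball:
  fixes m :: "'a metric"
  assumes dbl: "doubling m" and cpt: "compactin (mtopology_of m) (mcball_of m x R)"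
    and maps: "h ` mcball_of m x R \<subseteq> mcball_of m x R"
    and iso: "\<And>y z. y \<in> mspace m \<Longrightarrow> z \<in> mspace m \<Longrightarrow> mdist m (h y) (h z) = mdist m y z"
    and hM: "h \<in> mspace m \<rightarrow> mspace m"
  shows "h ` mcball_of m x R = mcball_of m x R"
proof (rule ccontr)
  interpret Metric_space "mspace m" "mdist m" by simp
  let ?C = "mcball_of m x R"
  assume "h ` ?C \<noteq> ?C"
  with maps obtain y where y: "y \<in> ?C" "y \<notin> h ` ?C" by blast
  have "Lipschitz_continuous_map m m h"
    unfolding Lipschitz_continuous_map_def using iso hM by (auto intro!: exI[of _ 1])
  then have "continuous_map (mtopology_of m) (mtopology_of m) h"
    by (rule Lipschitz_continuous_imp_continuous_map)
  then have "compactin (mtopology_of m) (h ` ?C)" using cpt image_compactin by blast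
  then have "closedin mtopology (h ` ?C)"
    unfolding mtopology_of_def by (rule compactin_imp_closedin[OF Hausdorff_space_mtopology])
  with y obtain e where e: "0 < e" "disjnt (h ` ?C) (mball y e)"
    unfolding closedin_metric by auto
  have step: "h a \<in> ?C" if "a \<in> ?C" for a using maps that by blast
  have iter: "(h ^^ n) y \<in> ?C" for n
    using y(1) step by (induction n) (simp_all del: in_mcball_of)
  have far: "e \<le> mdist m y ((h ^^ Suc n) y)" for n
  proof (rule ccontr)
    assume "\<not> ?thesis"
    then have "(h ^^ Suc n) y \<in> mball y e"
      using y iter[of "Suc n"] by auto
    moreover have "(h ^^ Suc n) y \<in> h ` ?C" using iter[of n] by auto
    ultimately show False using e by (auto simp: disjnt_iff)
  qed
  have shift: "mdist m ((h ^^ k) u) ((h ^^ k) v) = mdist m u v" if "u \<in> ?C" "v \<in> ?C" for u v k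
  proof (induction k)
    case (Suc k)
    have "(h ^^ k) a \<in> ?C" if "a \<in> ?C" for a
      using that by (induction k) (simp, metis step funpow.simps(2) o_apply)
    then have "(h ^^ k) u \<in> mspace m" "(h ^^ k) v \<in> mspace m"
      using that by (auto simp only: in_mcball_of)
    then show ?case using Suc iso by simp
  qed simp
  have sep: "e \<le> mdist m ((h ^^ i) y) ((h ^^ j) y)" if "i < j" for i j
  proof -
    obtain n where "j = i + Suc n" using \<open>i < j\<close> less_iff_Suc_add by auto
    then have "(h ^^ j) y = (h ^^ i) ((h ^^ Suc n) y)" by (simp only: funpow_add o_apply)
    then show ?thesis using shift[OF y(1) iter, of i "Suc n"] far[of n] by simp
  qed
  have "inj (\<lambda>n. (h ^^ n) y)"
  proof (rule linorder_injI)
    fix i j :: nat assume "i < j"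
    from sep[OF this] e(1) iter[of j] show "(h ^^ i) y \<noteq> (h ^^ j) y" by auto
  qed
  then have inf: "infinite (range (\<lambda>n. (h ^^ n) y))" using range_inj_infinite by blast
  \<comment> \<open>The radius is written as a multiple of \<open>e\<close> so that doubling applies
    with \<open>\<kappa> = R / e\<close>.\<close>
  have "range (\<lambda>n. (h ^^ n) y) \<subseteq> mcball_of m x (R / e * e)" using iter e(1) by auto
  moreover have "\<forall>a\<in>range (\<lambda>n. (h ^^ n) y). \<forall>b\<in>range (\<lambda>n. (h ^^ n) y). a \<noteq> b \<longrightarrow> e \<le> mdist m a b"
    using sep commute by (auto, metis linorder_neqE_nat)
  ultimately have "finite (range (\<lambda>n. (h ^^ n) y))"
    using dbl e(1) unfolding doubling_def by blast
  with inf show False by blast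
qed

text \<open>After subtracting the image of the origin and dividing by \<open>c\<close>, an isometry
  \<open>h\<close> fixing the origin remains. It maps every closed ball about the origin into
  itself, hence onto itself by compactness, and a preimage of \<open>u\<close> under
  \<open>h\<close> is a preimage of \<open>y\<close> under \<open>f\<close>.\<close>

lemma contracting_similarity_euclid_onto:
  assumes "contracting_similarity (euclid d) c f"
  shows "f ` mspace (euclid d) = mspace (euclid d)"
proof
  let ?M = "mspace (euclid d)" and ?D = "mdist (euclid d)"
  have c: "0 < c" and fM: "f \<in> ?M \<rightarrow> ?M"
    and f: "\<And>x y. x \<in> ?M \<Longrightarrow> y \<in> ?M \<Longrightarrow> ?D (f x) (f y) = c * ?D x y"
    using assms unfolding contracting_similarity_def by auto
  show "f ` ?M \<subseteq> ?M" using fM by auto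
  define o' :: "nat \<Rightarrow> real" where "o' = (\<lambda>_. 0)"
  define h where "h = (\<lambda>x i. (f x i - f o' i) / c)"
  have o': "o' \<in> ?M" by (simp add: o'_def)
  have fo: "f o' i = 0" if "d \<le> i" for i
    using funcset_mem[OF fM o'] that by simp
  have hM: "h \<in> ?M \<rightarrow> ?M"
  proof
    fix x assume "x \<in> ?M"
    then have "f x \<in> ?M" using fM by blast
    then show "h x \<in> ?M" using fo by (simp add: h_def)
  qed
  have iso: "?D (h y) (h z) = ?D y z" if "y \<in> ?M" "z \<in> ?M" for y z
  proof -
    have "?D (h y) (h z) = L2_set (\<lambda>i. (1 / c) * (f y i - f z i)) {..<d}"
      unfolding mdist_euclid h_def by (simp add: diff_divide_distrib)
    also have "\<dots> = (1 / c) * ?D (f y) (f z)"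
      using c by (subst L2_set_right_distrib[symmetric]) (auto simp: mdist_euclid)
    finally show ?thesis using f[OF that] c by simp
  qed
  have ho: "h o' = o'" by (simp add: h_def o'_def)
  show "?M \<subseteq> f ` ?M"
  proof
    fix y assume y: "y \<in> ?M"
    define u where "u = (\<lambda>i. (y i - f o' i) / c)"
    have u: "u \<in> ?M" using y fo by (simp add: u_def)
    define R where "R = ?D o' u"
    have "h ` mcball_of (euclid d) o' R \<subseteq> mcball_of (euclid d) o' R"
    proof clarify
      fix x assume x: "x \<in> mcball_of (euclid d) o' R"
      then have "?D o' (h x) = ?D o' x" using iso[of o' x] ho by (metis in_mcball_of)
      then show "h x \<in> mcball_of (euclid d) o' R" 
        using x funcset_mem[OF hM, of x] by (simp del: mspace_euclid)
    qed
    then have "h ` mcball_of (euclid d) o' R = mcball_of (euclid d) o' R"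
      by (intro isometry_onto_mcball doubling_euclid compactin_euclid_mcball iso hM)
    moreover have "u \<in> mcball_of (euclid d) o' R" using u o' by (simp add: R_def del: mspace_euclid)
    ultimately obtain x where x: "x \<in> ?M" "u = h x" by (metis imageE in_mcball_of)
    have "f x i = y i" for i using fun_cong[OF x(2), of i] c by (simp add: u_def h_def)
    then have "f x = y" by blast
    then show "y \<in> f ` ?M" using x by blast
  qed
qed

section \<open>Attractors in proper metric spaces\<close>

text \<open>Expanding the power by distributivity gives one product for each word of length
  \<open>n\<close>.\<close>

lemma sum_prod_list_words:
  fixes f :: "'b \<Rightarrow> real"
  assumes "finite A"
  shows "(\<Sum>w | set w \<subseteq> A \<and> length w = n. prod_list (map f w)) = (\<Sum>a\<in>A. f a) ^ n"
proof (induction n)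
  case (Suc n)
  let ?W = "\<lambda>n. {w. set w \<subseteq> A \<and> length w = n}"
  have "?W (Suc n) = (\<lambda>(a, w). a # w) ` (A \<times> ?W n)"
    by (auto simp: length_Suc_conv image_iff)
  moreover have "inj_on (\<lambda>(a, w). a # w) (A \<times> ?W n)" by (auto simp: inj_on_def)
  ultimately have "(\<Sum>w\<in>?W (Suc n). prod_list (map f w)) = (\<Sum>(a, w)\<in>A \<times> ?W n. f a * prod_list (map f w))"
    by (simp only:) (subst sum.reindex, auto simp: case_prod_beta)
  also have "\<dots> = (\<Sum>a\<in>A. f a) * (\<Sum>w\<in>?W n. prod_list (map f w))"
    by (simp add: sum_product sum.cartesian_product)
  finally show ?case using Suc by simp
next
  case 0
  have "{w::'b list. set w \<subseteq> A \<and> length w = 0} = {[]}" by auto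
  then show ?case by simp
qed

text \<open>Compactness of closed balls yields the attractor; doubling and surjectivity of the maps
  enter as hypotheses of the lower bound for the dimension.\<close>

locale similarity_system =
  fixes m :: "'a metric" and S :: "('a \<Rightarrow> 'a) list" and c :: "nat \<Rightarrow> real"
  assumes S_nonempty: "S \<noteq> []"
    and similarity: "i < length S \<Longrightarrow> contracting_similarity m (c i) (S ! i)"
    and mspace_nonempty: "mspace m \<noteq> {}"
    and proper: "compactin (mtopology_of m) (mcball_of m x R)"
begin

sublocale Metric_space "mspace m" "mdist m"
  by (rule Metric_space_mspace_mdist)

abbreviation "words \<equiv> {w. set w \<subseteq> {..<length S}}"
abbreviation "words_of n \<equiv> {w. set w \<subseteq> {..<length S} \<and> length w = n}"

text \<open>The first letter acts last, so on an invariant set the image under a word lies in the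
  image under each of its prefixes. Letters are indices, which keeps equal maps at different
  positions apart.\<close>

primrec S_word :: "nat list \<Rightarrow> 'a \<Rightarrow> 'a" where
  "S_word [] = id"
| "S_word (i # w) = S ! i \<circ> S_word w"

definition c_word :: "nat list \<Rightarrow> real" where
  "c_word w = prod_list (map c w)"

definition c_max :: real where "c_max = Max (c ` {..<length S})"
definition c_min :: real where "c_min = Min (c ` {..<length S})"

section \<open>Ratios and images of words\<close>

lemma c_word_simps [simp]: "c_word [] = 1" "c_word (i # w) = c i * c_word w"
  "c_word (v @ w) = c_word v * c_word w"
  by (simp_all add: c_word_def)

lemma S_word_append: "S_word (v @ w) = S_word v \<circ> S_word w"
  by (induction v) auto

lemma length_S_pos: "0 < length S"
  using S_nonempty by simp

lemma c_pos: "i < length S \<Longrightarrow> 0 < c i" and c_less_1: "i < length S \<Longrightarrow> c i < 1"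
  and S_maps: "i < length S \<Longrightarrow> S ! i \<in> mspace m \<rightarrow> mspace m"
  and S_dist: "i < length S \<Longrightarrow> x \<in> mspace m \<Longrightarrow> y \<in> mspace m \<Longrightarrow>
    mdist m ((S ! i) x) ((S ! i) y) = c i * mdist m x y"
  using similarity unfolding contracting_similarity_def by blast+

lemma c_le_max: "i < length S \<Longrightarrow> c i \<le> c_max"
  unfolding c_max_def by (intro Max_ge) auto

lemma c_ge_min: "i < length S \<Longrightarrow> c_min \<le> c i"
  unfolding c_min_def by (intro Min_le) auto

lemma c_max_bounds: "0 < c_max" "c_max < 1"
proof -
  have "c_max \<in> c ` {..<length S}"
    unfolding c_max_def using S_nonempty by (intro Max_in) auto
  then show "0 < c_max" "c_max < 1" using c_pos c_less_1 by auto
qed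

lemma c_min_pos: "0 < c_min"
proof -
  have "c_min \<in> c ` {..<length S}"
    unfolding c_min_def using S_nonempty by (intro Min_in) auto
  then show "0 < c_min" using c_pos by auto
qed

lemma c_word_pos: "w \<in> words \<Longrightarrow> 0 < c_word w"
  by (induction w) (auto simp: c_pos)

lemma c_word_le: "w \<in> words \<Longrightarrow> c_word w \<le> c_max ^ length w"
proof (induction w)
  case (Cons i w)
  then show ?case using c_word_pos[of w] c_max_bounds c_le_max[of i]
    by (auto intro!: mult_mono)
qed simp

lemma S_word_maps: "w \<in> words \<Longrightarrow> S_word w \<in> mspace m \<rightarrow> mspace m"
proof (induction w)
  case (Cons i w)
  then show ?case using S_maps[of i] by (auto simp: Pi_iff)
qed simp

lemma S_word_in: "w \<in> words \<Longrightarrow> x \<in> mspace m \<Longrightarrow> S_word w x \<in> mspace m"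
  using S_word_maps by blast

lemma S_word_dist:
  "w \<in> words \<Longrightarrow> x \<in> mspace m \<Longrightarrow> y \<in> mspace m \<Longrightarrow>
    mdist m (S_word w x) (S_word w y) = c_word w * mdist m x y"
proof (induction w)
  case (Cons i w)
  then show ?case using S_word_in[of w] by (simp add: S_dist)
qed simp

lemma inj_on_S_word:
  assumes "w \<in> words" shows "inj_on (S_word w) (mspace m)"
proof (rule inj_onI)
  fix x y assume *: "x \<in> mspace m" "y \<in> mspace m" "S_word w x = S_word w y"
  then have "c_word w * mdist m x y = 0"
    using S_word_dist[OF assms, of x y] S_word_in[OF assms, of y] by simp
  then show "x = y" using * c_word_pos[OF assms] by simp
qed

lemma S_word_subset:
  assumes "\<And>i. i < length S \<Longrightarrow> (S ! i) ` V \<subseteq> V"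
  shows "w \<in> words \<Longrightarrow> S_word w ` V \<subseteq> V"
proof (induction w)
  case (Cons i w)
  then show ?case using assms[of i] by fastforce
qed simp

lemma finite_words_of: "finite (words_of n)"
  by (rule finite_lists_length_eq) simp

lemma continuous_map_S: 
  assumes "i < length S" shows "continuous_map (mtopology_of m) (mtopology_of m) (S ! i)"
proof (rule Lipschitz_continuous_imp_continuous_map)
  show "Lipschitz_continuous_map m m (S ! i)"
    unfolding Lipschitz_continuous_map_def
    using S_maps[OF assms] S_dist[OF assms] by (auto intro!: exI[of _ "c i"])
qed

section \<open>The attractor: addresses, uniqueness and existence\<close>

lemma closedin_compactin: "compactin (mtopology_of m) K \<Longrightarrow> closedin (mtopology_of m) K"
  unfolding mtopology_of_def by (rule compactin_imp_closedin[OF Hausdorff_space_mtopology])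

text \<open>The predicate under the definite description in \<open>attractor\<close>, named so that
  existence and uniqueness can be proved before the description is evaluated.\<close>

definition is_attractor :: "'a set \<Rightarrow> bool" where
  "is_attractor E \<longleftrightarrow> E \<noteq> {} \<and> compactin (mtopology_of m) E \<and> E = (\<Union>f\<in>set S. f ` E)"

lemma is_attractor_compactin: "is_attractor E \<Longrightarrow> compactin (mtopology_of m) E"
  unfolding is_attractor_def by blast

lemma is_attractor_mspace: "is_attractor E \<Longrightarrow> E \<subseteq> mspace m"
  unfolding is_attractor_def using compactin_subset_topspace by fastforce

lemma is_attractor_image:
  assumes "is_attractor E" "i < length S" "x \<in> E" shows "(S ! i) x \<in> E"
proof -
  have "(S ! i) x \<in> (\<Union>f\<in>set S. f ` E)" using assms(2,3) by auto
  with assms(1) show ?thesis unfolding is_attractor_def by argo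
qed

lemma is_attractor_preimage:
  assumes "is_attractor E" "x \<in> E" obtains i y where "i < length S" "y \<in> E" "x = (S ! i) y"
proof -
  have "x \<in> (\<Union>f\<in>set S. f ` E)" using assms unfolding is_attractor_def by argo
  then show ?thesis using that by (auto simp: in_set_conv_nth)
qed

lemma is_attractor_word_image:
  assumes "is_attractor E" shows "w \<in> words \<Longrightarrow> x \<in> E \<Longrightarrow> S_word w x \<in> E"
  by (induction w) (auto intro: is_attractor_image[OF assms])

lemma is_attractor_word_preimage:
  assumes "is_attractor E" "x \<in> E"
  shows "\<exists>w y. w \<in> words_of n \<and> y \<in> E \<and> x = S_word w y"
  using assms(2)
proof (induction n arbitrary: x)
  case 0
  then show ?case by (intro exI[of _ "[]"]) auto
next
  case (Suc n)
  obtain i y where "i < length S" "y \<in> E" "x = (S ! i) y"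
    using is_attractor_preimage[OF assms(1) Suc.prems] .
  moreover obtain w z where "w \<in> words_of n" "z \<in> E" "y = S_word w z"
    using Suc.IH[OF \<open>y \<in> E\<close>] by blast
  ultimately show ?case by (intro exI[of _ "i # w"] exI[of _ z]) auto
qed

lemma compactin_bounded_union:
  assumes "compactin (mtopology_of m) E" "compactin (mtopology_of m) F"
  shows "\<exists>B>0. \<forall>x \<in> E \<union> F. \<forall>y \<in> E \<union> F. mdist m x y \<le> B"
proof -
  have "mbounded (E \<union> F)"
    using assms unfolding mbounded_Un mtopology_of_def by (simp add: compactin_imp_mbounded)
  then show ?thesis unfolding mbounded_alt_pos by blast
qed

text \<open>A point of \<open>E\<close> is the image of some \<open>y\<close> in \<open>E\<close>
  under a word of length \<open>n\<close>. The image of a fixed \<open>z\<close> in \<open>F\<close>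
  under the same word stays in \<open>F\<close> and is at distance at most
  \<open>c_max ^ n * B\<close>, so the point is a limit of points of \<open>F\<close>. This gives
  uniqueness and later places the attractor inside a closed box.\<close>

lemma is_attractor_subset_invariant:
  assumes E: "is_attractor E" and F: "closedin (mtopology_of m) F" "F \<noteq> {}"
    and inv: "\<And>i. i < length S \<Longrightarrow> (S ! i) ` F \<subseteq> F"
  shows "E \<subseteq> F"
proof
  fix x assume x: "x \<in> E"
  have FM: "F \<subseteq> mspace m" using closedin_subset[OF F(1)] by simp
  note EM = is_attractor_mspace[OF E]
  obtain z where z: "z \<in> F" using F by blast
  have "compactin (mtopology_of m) {z}" using z FM by (intro finite_imp_compactin) auto
  from compactin_bounded_union[OF is_attractor_compactin[OF E] this]
  obtain B where B: "0 < B" "\<And>y. y \<in> E \<Longrightarrow> mdist m y z \<le> B" by blast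
  show "x \<in> F"
  proof (rule ccontr)
    assume "x \<notin> F"
    then obtain e where e: "0 < e" "disjnt F (mball x e)"
      using x EM F(1) unfolding closedin_metric mtopology_of_def by auto
    obtain n where n: "c_max ^ n < e / B"
      using real_arch_pow_inv[of "e / B" c_max] c_max_bounds e B by auto
    obtain w y where wy: "w \<in> words_of n" "y \<in> E" "x = S_word w y"
      using is_attractor_word_preimage[OF E x] by blast
    have "mdist m x (S_word w z) = c_word w * mdist m y z"
      using wy z EM FM S_word_dist[of w y z] by auto
    also have "\<dots> \<le> c_max ^ n * B"
      using wy z B c_word_le[of w] c_word_pos[of w] c_max_bounds by (intro mult_mono) auto
    also have "\<dots> < e" using n B by (simp add: field_simps)
    finally have "S_word w z \<in> mball x e"
      using wy z x EM FM S_word_in[of w z] by auto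
    moreover have "S_word w z \<in> F" using S_word_subset[OF inv] wy z by blast
    ultimately show False using e by (auto simp: disjnt_iff)
  qed
qed

lemma is_attractor_subset:
  assumes E: "is_attractor E" and F: "is_attractor F" shows "E \<subseteq> F"
  using F is_attractor_image[OF F]
  by (intro is_attractor_subset_invariant[OF E] closedin_compactin is_attractor_compactin)
    (auto simp: is_attractor_def)

lemma is_attractor_unique: "is_attractor E \<Longrightarrow> is_attractor F \<Longrightarrow> E = F"
  by (simp add: is_attractor_subset subset_antisym)

text \<open>The radius is taken so large that every map moves the centre by at most
  \<open>(1 - c i) * R\<close>; the contracted radius \<open>c i * R\<close> fills up the
  rest.\<close>

lemma invariant_ball: 
  obtains a R where "a \<in> mspace m" "0 \<le> R" "\<And>i. i < length S \<Longrightarrow> (S ! i) ` mcball_of m a R \<subseteq> mcball_of m a R"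
proof -
  obtain a where a: "a \<in> mspace m" using mspace_nonempty by blast
  define R where "R = Max ((\<lambda>i. mdist m a ((S ! i) a) / (1 - c i)) ` {..<length S})"
  have R: "mdist m a ((S ! i) a) / (1 - c i) \<le> R" if "i < length S" for i
    unfolding R_def using that by (intro Max_ge) auto
  have "0 \<le> mdist m a ((S ! 0) a) / (1 - c 0)" using c_less_1[of 0] length_S_pos by simp
  with R[of 0] length_S_pos have R0: "0 \<le> R" by linarith
  have "(S ! i) x \<in> mcball_of m a R" if i: "i < length S" and x: "x \<in> mcball_of m a R" for i x
  proof -
    have Sx: "(S ! i) x \<in> mspace m" "(S ! i) a \<in> mspace m" using S_maps[OF i] x a by auto
    have "mdist m a ((S ! i) x) \<le> mdist m a ((S ! i) a) + c i * mdist m a x"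
      using triangle[of a "(S ! i) a" "(S ! i) x"] Sx a S_dist[OF i, of a x] x by simp
    also have "\<dots> \<le> (1 - c i) * R + c i * R"
      using R[OF i] c_less_1[OF i] c_pos[OF i] x
      by (intro add_mono mult_left_mono) (auto simp: field_simps)
    finally show ?thesis using Sx a by (simp add: algebra_simps)
  qed
  with a R0 show ?thesis using that by blast
qed

text \<open>
  The iterated images \<open>K n\<close> of an invariant ball decrease to the attractor. A point of their
  intersection lies in one fixed \<open>(S ! i) ` K n\<close> for all \<open>n\<close>, because there are finitely many \<open>i\<close>,
  and by injectivity its preimages in the \<open>K n\<close> coincide.
\<close>

lemma ex_is_attractor: "\<exists>E. is_attractor E"
proof -
  obtain a R where a: "a \<in> mspace m" "0 \<le> R"
    and inv: "\<And>i. i < length S \<Longrightarrow> (S ! i) ` mcball_of m a R \<subseteq> mcball_of m a R"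
    using invariant_ball by blast
  define F where "F = (\<lambda>X. \<Union>i<length S. (S ! i) ` X)"
  define K where "K = (\<lambda>n. (F ^^ n) (mcball_of m a R))"
  have K0: "K 0 = mcball_of m a R" and KSuc: "K (Suc n) = F (K n)" for n
    by (simp_all add: K_def)
  have F_mono: "X \<subseteq> Y \<Longrightarrow> F X \<subseteq> F Y" for X Y unfolding F_def by blast
  have step: "K (Suc n) \<subseteq> K n" for n
  proof (induction n)
    case 0
    show ?case unfolding KSuc K0 using inv unfolding F_def by blast
  qed (simp only: KSuc F_mono)
  then have dec: "decseq K" by (rule decseq_SucI)
  have cpt: "compactin (mtopology_of m) (K n)" for n
  proof (induction n)
    case (Suc n)
    show ?case unfolding KSuc F_def
      using image_compactin[OF Suc continuous_map_S] by (intro compactin_Union) auto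
  qed (simp add: K0 proper)
  have ne: "K n \<noteq> {}" for n
  proof (induction n)
    case 0 have "a \<in> K 0" using a by (simp add: K0)
    then show ?case by blast
  next
    case (Suc n) then show ?case using length_S_pos by (auto simp: KSuc F_def)
  qed
  define E where "E = (\<Inter>n. K n)"
  have "E \<noteq> {}"
  proof -
    have "compact_space (subtopology (mtopology_of m) (K 0))"
      using cpt by (simp add: compactin_subspace)
    moreover have "closedin (subtopology (mtopology_of m) (K 0)) (K n)" for n
      using closedin_compactin[OF cpt[of n]] decseqD[OF dec, of 0 n] closedin_subset_topspace by blast
    ultimately show ?thesis
      unfolding E_def using compact_space_imp_nest[of _ K] ne dec by blast
  qed
  moreover have "compactin (mtopology_of m) E"
  proof (rule closed_compactin[OF cpt[of 0]])
    show "E \<subseteq> K 0" unfolding E_def by blast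
    show "closedin (mtopology_of m) E"
      unfolding E_def using closedin_compactin[OF cpt] by blast
  qed
  moreover have "F E = E"
  proof
    have "F E \<subseteq> K n" for n
    proof -
      have "F E \<subseteq> F (K n)" unfolding E_def by (intro F_mono) blast
      then show ?thesis using step[of n] unfolding KSuc by blast
    qed
    then show "F E \<subseteq> E" unfolding E_def by blast
    show "E \<subseteq> F E"
    proof
      fix x assume x: "x \<in> E"
      define I where "I = (\<lambda>n. {i. i < length S \<and> x \<in> (S ! i) ` K n})"
      have "I n \<noteq> {}" for n
        using x INT_D[of x K UNIV "Suc n"] unfolding E_def I_def KSuc F_def by blast
      moreover have "decseq I"
        unfolding I_def using dec by (auto simp: decseq_def image_iff)
      moreover have "finite (I 0)" unfolding I_def by simp
      \<comment> \<open>Nested nonempty subsets of a finite set have a common element: the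
        compactness theorem for the discrete topology on \<open>I 0\<close>.\<close>
      ultimately have "(\<Inter>n. I n) \<noteq> {}"
        using compact_space_imp_nest[of "discrete_topology (I 0)" I]
        by (auto simp: compact_space_discrete_topology decseq_def)
      then obtain i where i: "i < length S" "\<And>n. x \<in> (S ! i) ` K n" unfolding I_def by blast
      then have "\<forall>n. \<exists>y. y \<in> K n \<and> x = (S ! i) y" by blast
      then obtain y where y: "\<And>n. y n \<in> K n" "\<And>n. x = (S ! i) (y n)" by metis
      have "inj_on (S ! i) (mspace m)" using inj_on_S_word[of "[i]"] i by simp
      moreover have "K n \<subseteq> mspace m" for n using compactin_subset_topspace[OF cpt] by simp
      ultimately have "y n = y 0" for n
        using y(1)[of n] y(1)[of 0] y(2)[of n] y(2)[of 0] by (simp add: inj_on_def subset_iff)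
      then have "y 0 \<in> K n" for n using y(1)[of n] by metis
      then have "y 0 \<in> E" unfolding E_def by simp
      with y(2)[of 0] i(1) show "x \<in> F E" unfolding F_def by blast
    qed
  qed
  moreover have "(\<Union>f\<in>set S. f ` E) = F E"
    unfolding F_def by (force simp: set_conv_nth)
  ultimately have "is_attractor E"
    unfolding is_attractor_def by simp
  then show ?thesis ..
qed

lemma is_attractor_attractor: "is_attractor (attractor m S)"
proof -
  have "\<exists>!E. is_attractor E" using ex_is_attractor is_attractor_unique by blast
  then show ?thesis unfolding attractor_def is_attractor_def by (rule theI')
qed

end

section \<open>Total disconnectedness from disjoint images\<close>

context similarity_system
begin

lemma continuous_map_S_word:
  "w \<in> words \<Longrightarrow> continuous_map (mtopology_of m) (mtopology_of m) (S_word w)"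
  by (induction w) (auto intro: continuous_map_compose continuous_map_S simp: id_def)

text \<open>By induction on \<open>n\<close>, a connected subset lies in the image of the attractor
  under a single word of length \<open>n\<close>. The diameters of these images are at most
  \<open>c_max ^ n * B\<close>, so the subset has at most one point.\<close>

lemma mtotally_disconnected_attractor:
  assumes disj: "\<And>i j. i < length S \<Longrightarrow> j < length S \<Longrightarrow> i \<noteq> j \<Longrightarrow>
    disjnt ((S ! i) ` attractor m S) ((S ! j) ` attractor m S)"
  shows "mtotally_disconnected m (attractor m S)"
proof -
  let ?E = "attractor m S"
  note E = is_attractor_attractor
  note EM = is_attractor_mspace[OF E]
  have cl: "closedin (mtopology_of m) (S_word w ` ?E)" if "w \<in> words" for w
    by (intro closedin_compactin image_compactin[OF is_attractor_compactin[OF E]] continuous_map_S_word that)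
  have split: "S_word w ` ?E = (\<Union>i<length S. S_word (w @ [i]) ` ?E)" for w
  proof -
    have "?E = (\<Union>i<length S. (S ! i) ` ?E)"
    proof (intro equalityI subsetI)
      fix x assume "x \<in> ?E"
      then obtain i y where "i < length S" "y \<in> ?E" "x = (S ! i) y"
        by (rule is_attractor_preimage[OF E])
      then show "x \<in> (\<Union>i<length S. (S ! i) ` ?E)" by blast
    qed (use is_attractor_image[OF E] in blast)
    then have "S_word w ` ?E = (\<Union>i<length S. S_word w ` (S ! i) ` ?E)" by (metis image_UN)
    then show ?thesis by (simp add: S_word_append image_comp)
  qed
  have in_word: "\<exists>w\<in>words_of n. C \<subseteq> S_word w ` ?E"
    if C: "connectedin (mtopology_of m) C" "C \<subseteq> ?E" "x \<in> C" for C x n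
  proof (induction n)
    case 0
    show ?case using C by (intro bexI[of _ "[]"]) auto
  next
    case (Suc n)
    then obtain w where w: "w \<in> words_of n" "C \<subseteq> S_word w ` ?E" by blast
    then obtain i where i: "i < length S" "x \<in> S_word (w @ [i]) ` ?E" using split[of w] C(3) by blast
    \<comment> \<open>Inside the piece of \<open>w\<close>, the sub-piece containing
      \<open>x\<close> and the union of the others are closed and, by injectivity of
      \<open>S_word w\<close>, disjoint.\<close>
    let ?P = "S_word (w @ [i]) ` ?E" and ?Q = "\<Union>j\<in>{..<length S} - {i}. S_word (w @ [j]) ` ?E"
    have "closedin (mtopology_of m) ?P" using w i by (intro cl) auto
    moreover have "closedin (mtopology_of m) ?Q" using w by (intro closedin_Union) (auto intro!: cl)
    moreover have "C \<subseteq> ?P \<union> ?Q" using w(2) split[of w] by auto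
    moreover have "?P \<inter> ?Q = {}"
    proof (rule ccontr)
      assume "?P \<inter> ?Q \<noteq> {}"
      then obtain j y z where j: "j < length S" "j \<noteq> i" "y \<in> ?E" "z \<in> ?E"
        "S_word w ((S ! i) y) = S_word w ((S ! j) z)"
        by (auto simp: S_word_append)
      have "(S ! i) y \<in> mspace m" "(S ! j) z \<in> mspace m"
        using is_attractor_image[OF E i(1) j(3)] is_attractor_image[OF E j(1,4)] EM by auto
      then have "(S ! i) y = (S ! j) z" using inj_on_S_word[of w] w(1) j(5) by (auto dest: inj_onD)
      then show False using disj[OF i(1) j(1)] j by (auto simp: disjnt_iff)
    qed
    ultimately have "?Q \<inter> C = {}"
      using C(1,3) i(2) unfolding connectedin_closedin by blast
    with \<open>C \<subseteq> ?P \<union> ?Q\<close> have "C \<subseteq> ?P" by blast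
    then show ?case using w i by (intro bexI[of _ "w @ [i]"]) auto
  qed
  obtain B where B: "0 < B" "\<And>x y. x \<in> ?E \<Longrightarrow> y \<in> ?E \<Longrightarrow> mdist m x y \<le> B"
    using compactin_bounded_union[OF is_attractor_compactin[OF E] is_attractor_compactin[OF E]] by auto
  have "x = y" if C: "connectedin (mtopology_of m) C" "C \<subseteq> ?E" "x \<in> C" "y \<in> C" for C x y
  proof (rule ccontr)
    assume "x \<noteq> y"
    then have pos: "0 < mdist m x y" using C EM by (simp add: mdist_pos_eq subset_iff)
    obtain n where n: "c_max ^ n < mdist m x y / B"
      using real_arch_pow_inv[of "mdist m x y / B" c_max] c_max_bounds pos B by auto
    obtain w where w: "w \<in> words_of n" "C \<subseteq> S_word w ` ?E" 
      using in_word[OF C(1-3), of n] by (elim bexE)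
    have "x \<in> S_word w ` ?E" "y \<in> S_word w ` ?E" using w(2) C(3,4) by auto
    then obtain x' y' where xy: "x' \<in> ?E" "y' \<in> ?E" "x = S_word w x'" "y = S_word w y'"
      by (elim imageE)
    have "mdist m x y = c_word w * mdist m x' y'" using xy w EM S_word_dist[of w x' y'] by auto
    also have "\<dots> \<le> c_max ^ n * B"
      using w xy B c_word_le[of w] c_word_pos[of w] c_max_bounds by (intro mult_mono) auto
    also have "\<dots> < mdist m x y" using n B by (simp add: field_simps)
    finally show False by simp
  qed
  then show ?thesis unfolding mtotally_disconnected_def by blast
qed

end

section \<open>The Hausdorff dimension of the attractor\<close>

lemma mdiameter_le:
  assumes "0 \<le> b" "\<And>x y. x \<in> U \<Longrightarrow> y \<in> U \<Longrightarrow> mdist m x y \<le> b"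
  shows "mdiameter m U \<le> b"
  using assms unfolding mdiameter_def by (auto intro!: cSUP_least)

lemma mdist_le_mdiameter:
  assumes "\<And>x y. x \<in> U \<Longrightarrow> y \<in> U \<Longrightarrow> mdist m x y \<le> b" "x \<in> U" "y \<in> U"
  shows "mdist m x y \<le> mdiameter m U"
proof -
  have "mdist m x y \<le> (SUP (x, y)\<in>U \<times> U. mdist m x y)"
    using assms by (intro cSUP_upper2[where x = "(x, y)"] bdd_aboveI2[of _ _ b]) auto
  then show ?thesis using assms by (auto simp: mdiameter_def)
qed

lemma mdiameter_nonneg:
  assumes "\<And>x y. x \<in> U \<Longrightarrow> y \<in> U \<Longrightarrow> mdist m x y \<le> b"
  shows "0 \<le> mdiameter m U"
proof (cases "U = {}")
  case False
  then obtain x where "x \<in> U" by blast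
  with mdist_le_mdiameter[of U m b, OF assms, of x x] show ?thesis
    using mdist_nonneg[of m x x] by linarith
qed (simp add: mdiameter_def)

text \<open>This replaces a covering set of diameter \<open>d\<close>, possibly zero, by an open
  ball of larger radius at small cost. The number \<open>u\<close> solves
  \<open>u powr t = d powr t + e / 2\<close>; the minimum with the midpoint of \<open>d\<close> and
  1 keeps the radius below 1.\<close>

lemma ex_powr_close_above:
  fixes d t e :: real
  assumes "0 \<le> d" "d < 1" "0 < t" "0 < e"
  shows "\<exists>\<rho>. d < \<rho> \<and> \<rho> < 1 \<and> \<rho> powr t < d powr t + e"
proof -
  define u where "u = (d powr t + e / 2) powr (1 / t)"
  have ut: "u powr t = d powr t + e / 2"
    using assms by (simp add: u_def powr_powr add_nonneg_pos)
  have "d < u"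
  proof (rule ccontr)
    assume "\<not> d < u"
    then have "u powr t \<le> d powr t" using assms by (intro powr_mono2) (auto simp: u_def)
    with ut assms show False by simp
  qed
  define \<rho> where "\<rho> = min u ((d + 1) / 2)"
  have "(d + 1) / 2 < 1" "d < (d + 1) / 2" using assms by simp_all
  moreover have "\<rho> powr t \<le> u powr t" using assms by (intro powr_mono2) (auto simp: \<rho>_def u_def)
  ultimately show ?thesis using ut assms \<open>d < u\<close> unfolding \<rho>_def by (intro exI[of _ "min u ((d + 1) / 2)"]) (simp add: min_less_iff_disj)
qed

section \<open>Upper bound for the Hausdorff dimension\<close>

context similarity_system
begin

lemma c_word_powr:
  assumes "w \<in> words" shows "c_word w powr t = prod_list (map (\<lambda>i. c i powr t) w)"
  using assms
proof (induction w)
  case (Cons i w)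
  then show ?case using c_pos[of i] c_word_pos[of w] by (simp add: powr_mult)
qed simp

lemma sum_c_word_powr: "(\<Sum>w\<in>words_of n. c_word w powr t) = (\<Sum>i<length S. c i powr t) ^ n"
proof -
  have "(\<Sum>w\<in>words_of n. c_word w powr t) = (\<Sum>w\<in>words_of n. prod_list (map (\<lambda>i. c i powr t) w))"
    by (intro sum.cong) (auto simp: c_word_powr)
  then show ?thesis by (simp add: sum_prod_list_words)
qed

abbreviation "E \<equiv> attractor m S"

lemma E_mspace: "E \<subseteq> mspace m"
  using is_attractor_mspace is_attractor_attractor .

lemma E_nonempty: "E \<noteq> {}"
  using is_attractor_attractor is_attractor_def by blast

text \<open>The images of the attractor under the words of length \<open>n\<close> form a cover
  whose sum of powers is at most \<open>\<sigma> ^ n * B powr t\<close>, which tends to 0, as does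
  the mesh of the cover.\<close>

lemma hausdorff_content_attractor_le:
  assumes "0 < t" and sum: "(\<Sum>i<length S. c i powr t) < 1" and "0 < \<delta>" "0 < \<epsilon>"
  shows "hausdorff_content m t \<delta> E \<le> ennreal \<epsilon>"
proof -
  have E: "compactin (mtopology_of m) E" using is_attractor_attractor is_attractor_compactin by blast
  obtain B where B: "0 < B" "\<And>x y. x \<in> E \<Longrightarrow> y \<in> E \<Longrightarrow> mdist m x y \<le> B"
    using compactin_bounded_union[OF E E] by auto
  define \<sigma> where "\<sigma> = (\<Sum>i<length S. c i powr t)"
  have \<sigma>: "0 \<le> \<sigma>" "\<sigma> < 1" using sum by (auto simp: \<sigma>_def sum_nonneg)
  have lim: "(\<lambda>n. q ^ n * b) \<longlonglongrightarrow> 0" if "0 \<le> q" "q < 1" for q b :: real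
    by (rule tendsto_mult_left_zero[OF LIMSEQ_realpow_zero[OF that]])
  have "\<forall>\<^sub>F n in sequentially. c_max ^ n * B < \<delta> \<and> \<sigma> ^ n * B powr t < \<epsilon>"
    using order_tendstoD(2)[OF lim \<open>0 < \<delta>\<close>, of c_max B] order_tendstoD(2)[OF lim[OF \<sigma>] \<open>0 < \<epsilon>\<close>]
      c_max_bounds by (intro eventually_conj) simp_all
  then obtain n where n: "c_max ^ n * B < \<delta>" "\<sigma> ^ n * B powr t < \<epsilon>"
    unfolding eventually_sequentially by auto
  obtain ws where ws: "set ws = words_of n" "distinct ws"
    using finite_distinct_list[OF finite_words_of] by blast
  \<comment> \<open>The finite cover is padded with empty sets to a sequence; their diameter is 0
    and so is its power.\<close>
  define U where "U = (\<lambda>k. if k < length ws then S_word (ws ! k) ` E else {})"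
  have nth: "ws ! k \<in> words_of n" if "k < length ws" for k using ws that nth_mem by blast
  have diam: "mdist m x y \<le> c_word (ws ! k) * B" if "k < length ws" "x \<in> U k" "y \<in> U k" for k x y
    using that nth[OF that(1)] B(2) E_mspace
    by (auto simp: U_def S_word_dist subset_iff intro!: mult_left_mono less_imp_le[OF c_word_pos])
  have cover: "E \<subseteq> (\<Union>k. U k)"
  proof
    fix x assume "x \<in> E"
    then obtain w y where "w \<in> words_of n" "y \<in> E" "x = S_word w y"
      using is_attractor_word_preimage[OF is_attractor_attractor] by meson
    moreover then obtain k where "k < length ws" "w = ws ! k" using ws by (metis in_set_conv_nth)
    ultimately have "x \<in> U k" by (simp add: U_def)
    then show "x \<in> (\<Union>k. U k)" by blast
  qed
  have small: "U k \<subseteq> mspace m \<and> (\<forall>x\<in>U k. \<forall>y\<in>U k. mdist m x y \<le> \<delta>)" for k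
  proof (cases "k < length ws")
    case True
    have "c_word (ws ! k) * B \<le> c_max ^ n * B"
      using c_word_le[of "ws ! k"] nth[OF True] B(1) by (intro mult_right_mono) auto
    then have "mdist m x y \<le> \<delta>" if "x \<in> U k" "y \<in> U k" for x y
      using diam[OF True that] n by linarith
    moreover have "U k \<subseteq> mspace m"
      using True nth[OF True] S_word_in E_mspace by (auto simp: U_def)
    ultimately show ?thesis by blast
  qed (simp add: U_def)
  have "hausdorff_content m t \<delta> E \<le> (\<Sum>k. ennreal (mdiameter m (U k) powr t))"
    unfolding hausdorff_content_def using cover small by (intro INF_lower) blast
  also have "\<dots> = (\<Sum>k<length ws. ennreal (mdiameter m (U k) powr t))"
    using assms(1) by (intro suminf_finite) (auto simp: U_def mdiameter_def)
  also have "\<dots> \<le> (\<Sum>k<length ws. ennreal ((c_word (ws ! k) * B) powr t))"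
  proof (intro sum_mono ennreal_leI)
    fix k assume "k \<in> {..<length ws}"
    then have k: "k < length ws" by simp
    show "mdiameter m (U k) powr t \<le> (c_word (ws ! k) * B) powr t"
    proof (rule powr_mono2)
      show "mdiameter m (U k) \<le> c_word (ws ! k) * B"
        using c_word_pos[of "ws ! k"] nth[OF k] B diam[OF k] by (intro mdiameter_le) auto
    qed (use assms mdiameter_nonneg[OF diam[OF k]] in auto)
  qed
  also have "\<dots> = ennreal (\<Sum>k<length ws. (c_word (ws ! k) * B) powr t)" by simp
  also have "(\<Sum>k<length ws. (c_word (ws ! k) * B) powr t) = (\<Sum>w\<in>words_of n. (c_word w * B) powr t)"
    by (rule sum.reindex_bij_betw) (use bij_betw_nth[OF ws(2), of "{..<length ws}"] ws in auto)
  also have "\<dots> = (\<Sum>w\<in>words_of n. c_word w powr t) * B powr t"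
    unfolding sum_distrib_right using B(1) less_imp_le[OF c_word_pos] by (intro sum.cong) (auto simp: powr_mult)
  also have "\<dots> = \<sigma> ^ n * B powr t" by (simp add: sum_c_word_powr \<sigma>_def)
  also have "ennreal \<dots> \<le> ennreal \<epsilon>" using n by (intro ennreal_leI) simp
  finally show ?thesis .
qed

lemma hausdorff_measure_attractor_eq_0:
  assumes "0 < t" "(\<Sum>i<length S. c i powr t) < 1"
  shows "hausdorff_measure m t E = 0"
proof -
  have "hausdorff_content m t \<delta> E \<le> 0" if "0 < \<delta>" for \<delta>
  proof (rule ennreal_le_epsilon)
    fix e :: real assume "0 < e"
    from hausdorff_content_attractor_le[OF assms that this]
    show "hausdorff_content m t \<delta> E \<le> 0 + ennreal e" by simp
  qed
  then have "hausdorff_measure m t E \<le> 0"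
    unfolding hausdorff_measure_def by (intro SUP_least) auto
  then show ?thesis by simp
qed

section \<open>Lower bound for the Hausdorff dimension\<close>

text \<open>A discrete substitute for the mass distribution principle.\<close>

lemma cut_set_sum:
  assumes sum: "(\<Sum>i<length S. c i powr s) = 1"
    and W: "finite W" "W \<subseteq> words" and cut: "\<And>w. w \<in> words_of n \<Longrightarrow> \<exists>v\<in>W. prefix v w"
  shows "1 \<le> (\<Sum>v\<in>W. c_word v powr s)"
proof -
  have "1 = (\<Sum>w\<in>words_of n. c_word w powr s)" by (simp add: sum_c_word_powr sum)
  also have "\<dots> \<le> (\<Sum>w\<in>words_of n. \<Sum>v\<in>W. if prefix v w then c_word w powr s else 0)"
  proof (rule sum_mono)
    fix w assume "w \<in> words_of n"
    then obtain v where v: "v \<in> W" "prefix v w" using cut by blast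
    have "(if prefix v w then c_word w powr s else 0)
        \<le> (\<Sum>v\<in>W. if prefix v w then c_word w powr s else 0)"
      by (rule member_le_sum) (use v W in auto)
    then show "c_word w powr s \<le> (\<Sum>v\<in>W. if prefix v w then c_word w powr s else 0)"
      using v by simp
  qed
  also have "\<dots> = (\<Sum>v\<in>W. \<Sum>w\<in>words_of n. if prefix v w then c_word w powr s else 0)"
    by (rule sum.swap)
  also have "\<dots> = (\<Sum>v\<in>W. \<Sum>w | w \<in> words_of n \<and> prefix v w. c_word w powr s)"
    by (intro sum.cong refl sum.inter_filter[symmetric] finite_words_of)
  also have "\<dots> \<le> (\<Sum>v\<in>W. c_word v powr s)"
  proof (intro sum_mono)
    fix v assume "v \<in> W"
    then have v: "v \<in> words" using W by blast
    show "(\<Sum>w | w \<in> words_of n \<and> prefix v w. c_word w powr s) \<le> c_word v powr s"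
    proof (cases "length v \<le> n")
      case True
      \<comment> \<open>The extensions of \<open>v\<close> to length \<open>n\<close> carry total
        weight \<open>c_word v powr s\<close>, since the weights of the words of any fixed length
        sum to 1.\<close>
      have "{w. w \<in> words_of n \<and> prefix v w} = (@) v ` words_of (n - length v)"
        using True v by (auto simp: prefix_def)
      then have "(\<Sum>w | w \<in> words_of n \<and> prefix v w. c_word w powr s)
          = (\<Sum>w\<in>words_of (n - length v). c_word (v @ w) powr s)"
        by (simp only:) (subst sum.reindex, auto simp: inj_on_def)
      also have "\<dots> = c_word v powr s * (\<Sum>w\<in>words_of (n - length v). c_word w powr s)"
        unfolding sum_distrib_left
        using less_imp_le[OF c_word_pos] v by (intro sum.cong) (auto simp: powr_mult)
      finally show ?thesis by (simp add: sum_c_word_powr sum)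
    next
      case False
      then have "{w. w \<in> words_of n \<and> prefix v w} = {}" by (auto dest: prefix_length_le)
      then show ?thesis by (simp only: sum.empty) simp
    qed
  qed
  finally show ?thesis .
qed

text \<open>The usual cut set at scale \<open>\<rho>\<close>: the words whose ratio has just dropped
  to \<open>\<rho>\<close> or below.\<close>

definition stopping :: "real \<Rightarrow> nat list set" where
  "stopping \<rho> = {w \<in> words. w \<noteq> [] \<and> c_word w \<le> \<rho> \<and> \<rho> < c_word (butlast w)}"

lemma stopping_words: "w \<in> stopping \<rho> \<Longrightarrow> w \<in> words"
  by (simp add: stopping_def)

text \<open>Letters are removed from the end as long as the ratio stays at most
  \<open>\<rho>\<close>; the empty word has ratio 1 and so is never reached.\<close>

lemma ex_stopping_prefix:
  assumes "\<rho> < 1" shows "w \<in> words \<Longrightarrow> c_word w \<le> \<rho> \<Longrightarrow> \<exists>v\<in>stopping \<rho>. prefix v w"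
proof (induction w rule: rev_induct)
  case Nil then show ?case using assms by simp
next
  case (snoc i w)
  show ?case
  proof (cases "c_word w \<le> \<rho>")
    case True
    then show ?thesis using snoc by (auto simp: prefix_snoc)
  next
    case False
    then have "w @ [i] \<in> stopping \<rho>" using snoc.prems unfolding stopping_def by auto
    then show ?thesis by blast
  qed
qed

text \<open>Before the last letter the ratio exceeded \<open>\<rho>\<close>, and one letter
  multiplies it by at least \<open>c_min\<close>.\<close>

lemma stopping_ge:
  assumes w: "w \<in> stopping \<rho>" shows "c_min * \<rho> \<le> c_word w"
proof -
  obtain v i where wv: "w = v @ [i]" 
    using w by (cases w rule: rev_exhaust) (auto simp: stopping_def)
  then have "\<rho> < c_word v" "i < length S" "v \<in> words" using w by (auto simp: stopping_def)
  have "c_min * \<rho> \<le> c_min * c_word v"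
    using \<open>\<rho> < c_word v\<close> c_min_pos by (intro mult_left_mono) auto
  also have "\<dots> \<le> c i * c_word v"
    using c_ge_min[OF \<open>i < length S\<close>] c_word_pos[OF \<open>v \<in> words\<close>] by (intro mult_right_mono) auto
  finally show ?thesis using wv by (simp add: mult.commute)
qed

lemma c_word_antimono_prefix:
  assumes "w \<in> words" "prefix v w" shows "c_word w \<le> c_word v"
proof -
  obtain u where u: "w = v @ u" using assms by (auto simp: prefix_def)
  then have "c_word u \<le> 1" using assms c_word_le[of u] c_max_bounds
      power_le_one[of c_max "length u"] by auto
  moreover have "0 < c_word v" using u assms by (intro c_word_pos) auto
  ultimately show ?thesis using u by (simp add: mult_left_le)
qed

text \<open>A proper prefix of \<open>w\<close> is a prefix of \<open>butlast w\<close>, so its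
  ratio still exceeds \<open>\<rho>\<close>.\<close>

lemma stopping_antichain:
  assumes "w \<in> stopping \<rho>" "v \<in> stopping \<rho>" "prefix v w" shows "v = w"
proof (rule ccontr)
  assume "v \<noteq> w"
  then have "prefix v (butlast w)"
    using assms by (metis prefix_snoc append_butlast_last_id prefix_Nil)
  moreover have "butlast w \<in> words" using assms by (auto simp: stopping_def dest: in_set_butlastD)
  ultimately have "c_word (butlast w) \<le> c_word v" by (intro c_word_antimono_prefix)
  then show False using assms by (auto simp: stopping_def)
qed

lemma S_word_onto:
  assumes "\<And>i. i < length S \<Longrightarrow> (S ! i) ` mspace m = mspace m"
  shows "w \<in> words \<Longrightarrow> S_word w ` mspace m = mspace m"
proof (induction w)
  case (Cons i w)
  then have "S_word w ` mspace m = mspace m" "i < length S" by auto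
  then show ?case using assms[of i] by (simp only: S_word.simps image_comp[symmetric])
qed simp

lemma stopping_separated:
  assumes onto: "\<And>i. i < length S \<Longrightarrow> (S ! i) ` mspace m = mspace m"
    and VM: "V \<subseteq> mspace m"
    and VV: "\<And>i. i < length S \<Longrightarrow> (S ! i) ` V \<subseteq> V"
    and disj: "\<And>i j. i < length S \<Longrightarrow> j < length S \<Longrightarrow> i \<noteq> j \<Longrightarrow> disjnt ((S ! i) ` V) ((S ! j) ` V)"
    and a: "a \<in> mspace m" and e: "0 < e" "mball a e \<subseteq> V"
    and w: "w \<in> stopping \<rho>" and v: "v \<in> stopping \<rho>" and "w \<noteq> v"
  shows "e * c_min * \<rho> \<le> mdist m (S_word w a) (S_word v a)"
proof (rule ccontr)
  assume "\<not> ?thesis"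
  then have "mdist m (S_word w a) (S_word v a) < e * c_min * \<rho>" by simp
  also have "e * c_min * \<rho> \<le> e * c_word w" using stopping_ge[OF w] e by (simp add: mult.assoc)
  finally have less: "mdist m (S_word w a) (S_word v a) < e * c_word w" by simp
  note words = stopping_words[OF w] stopping_words[OF v]
  have "w \<parallel> v" using stopping_antichain[OF w v] stopping_antichain[OF v w] \<open>w \<noteq> v\<close> by (auto intro: parallelI)
  then obtain u i w' j v' where dec: "i \<noteq> j" "w = u @ i # w'" "v = u @ j # v'"
    using parallel_decomp by blast
  have aV: "a \<in> V" using a e by auto
  have "S_word v a \<in> mspace m" using S_word_in words a by blast
  \<comment> \<open>Surjectivity pulls \<open>S_word v a\<close> back through \<open>w\<close>; if
    it is too close to \<open>S_word w a\<close>, its preimage \<open>b\<close> falls into the ball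
    about \<open>a\<close> and hence into \<open>V\<close>.\<close>
  then obtain b where b: "b \<in> mspace m" "S_word v a = S_word w b"
    using S_word_onto[OF onto words(1)] by (metis imageE)
  have "c_word w * mdist m a b < c_word w * e"
    using less b a S_word_dist[OF words(1)] by (simp add: mult.commute)
  then have "b \<in> V" using c_word_pos[OF words(1)] a b e by (auto simp: subset_iff)
  have ij: "i < length S" "j < length S" "u \<in> words" "w' \<in> words" "v' \<in> words" using dec words by auto
  have inV: "S_word w' b \<in> V" "S_word v' a \<in> V"
    using S_word_subset[OF VV] ij \<open>b \<in> V\<close> aV by blast+
  have "S_word u ((S ! i) (S_word w' b)) = S_word u ((S ! j) (S_word v' a))"
    using b(2) dec by (simp add: S_word_append)
  then have "(S ! i) (S_word w' b) = (S ! j) (S_word v' a)"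
    using inj_on_S_word[OF ij(3)] inV VM VV ij by (auto dest!: inj_onD)
  moreover have "(S ! i) (S_word w' b) \<in> (S ! i) ` V" "(S ! j) (S_word v' a) \<in> (S ! j) ` V" using inV by auto
  ultimately show False using disj[OF ij(1,2) dec(1)] by (auto simp: disjnt_iff)
qed

text \<open>Each such word sends \<open>a\<close> to a point within \<open>(1 + B) * \<rho>\<close>
  of \<open>x\<close>, where \<open>B\<close> bounds the distances from the attractor to
  \<open>a\<close>. These points are \<open>k * \<rho>\<close> apart, so doubling at the scale ratio
  \<open>\<kappa> = (1 + B) / k\<close> bounds their number.\<close>

lemma stopping_meeting_ball:
  assumes dbl: "doubling m"
    and onto: "\<And>i. i < length S \<Longrightarrow> (S ! i) ` mspace m = mspace m"
    and osc: "open_set_condition m S"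
  shows "\<exists>q::nat. \<forall>\<rho> x. 0 < \<rho> \<longrightarrow>
    finite {w \<in> stopping \<rho>. S_word w ` E \<inter> mball x \<rho> \<noteq> {}} \<and>
    card {w \<in> stopping \<rho>. S_word w ` E \<inter> mball x \<rho> \<noteq> {}} \<le> q"
proof -
  obtain V where V: "V \<noteq> {}" "openin mtopology V"
    and V': "\<forall>i<length S. (S ! i) ` V \<subseteq> V"
      "\<forall>i<length S. \<forall>j<length S. i \<noteq> j \<longrightarrow> disjnt ((S ! i) ` V) ((S ! j) ` V)"
    using osc unfolding open_set_condition_def mtopology_of_def by (elim exE conjE)
  have VV: "\<And>i. i < length S \<Longrightarrow> (S ! i) ` V \<subseteq> V"
    and disj: "\<And>i j. i < length S \<Longrightarrow> j < length S \<Longrightarrow> i \<noteq> j \<Longrightarrow> disjnt ((S ! i) ` V) ((S ! j) ` V)"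
    using V' by simp_all
  have VM: "V \<subseteq> mspace m" using V(2) openin_mtopology by blast
  obtain a where "a \<in> V" using V by blast
  then obtain e where e: "0 < e" "mball a e \<subseteq> V" using V(2) openin_mtopology by blast
  have a: "a \<in> mspace m" using \<open>a \<in> V\<close> VM by blast
  have "compactin (mtopology_of m) {a}" using a by (intro finite_imp_compactin) auto
  from compactin_bounded_union[OF is_attractor_compactin[OF is_attractor_attractor] this]
  obtain B where B: "0 < B" "\<And>y. y \<in> E \<Longrightarrow> mdist m y a \<le> B" by blast
  define k where "k = e * c_min"
  have k: "0 < k" using e c_min_pos by (simp add: k_def)
  define \<kappa> where "\<kappa> = (1 + B) / k"
  obtain q :: nat where q: "\<And>x \<eta> A. 0 < \<eta> \<Longrightarrow> A \<subseteq> mcball_of m x (\<kappa> * \<eta>) \<Longrightarrow>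
     (\<forall>y\<in>A. \<forall>z\<in>A. y \<noteq> z \<longrightarrow> \<eta> \<le> mdist m y z) \<Longrightarrow> finite A \<and> card A \<le> q"
    using dbl unfolding doubling_def by meson
  have "finite W \<and> card W \<le> q"
    if \<rho>: "0 < \<rho>" and W: "W = {w \<in> stopping \<rho>. S_word w ` E \<inter> mball x \<rho> \<noteq> {}}" for \<rho> x W
  proof -
    let ?f = "\<lambda>w. S_word w a"
    have sep: "k * \<rho> \<le> mdist m (?f w) (?f v)" if "w \<in> W" "v \<in> W" "w \<noteq> v" for w v
      unfolding k_def using that W by (intro stopping_separated[OF onto VM VV disj a e]) auto
    have inj: "inj_on ?f W"
    proof (rule inj_onI, rule ccontr)
      fix w v assume *: "w \<in> W" "v \<in> W" "?f w = ?f v" "w \<noteq> v"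
      have "?f v \<in> mspace m" using * W a by (intro S_word_in stopping_words) auto
      then have "k * \<rho> \<le> 0" using sep[OF *(1,2,4)] *(3) by simp
      then show False using k \<rho> mult_pos_pos[OF k \<rho>] by linarith
    qed
    have "?f ` W \<subseteq> mcball_of m x (\<kappa> * (k * \<rho>))"
    proof (rule image_subsetI)
      fix w assume "w \<in> W"
      then obtain y where y: "y \<in> E" "S_word w y \<in> mball x \<rho>" and w: "w \<in> stopping \<rho>"
        unfolding W by blast
      have ww: "w \<in> words" and yM: "y \<in> mspace m" using stopping_words[OF w] y E_mspace by auto
      have "mdist m x (?f w) \<le> mdist m x (S_word w y) + mdist m (S_word w y) (?f w)"
        using y S_word_in[OF ww] a yM by (intro triangle) auto
      also have "mdist m (S_word w y) (?f w) = c_word w * mdist m y a"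
        using S_word_dist[OF ww yM a] .
      also have "\<dots> \<le> \<rho> * B"
        using w B(2)[OF y(1)] \<rho> by (intro mult_mono) (auto simp: stopping_def)
      also have "mdist m x (S_word w y) + \<rho> * B \<le> (1 + B) * \<rho>" using y by (auto simp: algebra_simps)
      also have "\<dots> = \<kappa> * (k * \<rho>)" using k by (simp add: \<kappa>_def)
      finally show "?f w \<in> mcball_of m x (\<kappa> * (k * \<rho>))"
        using y S_word_in[OF ww a] by simp
    qed
    moreover have "\<forall>y\<in>?f ` W. \<forall>z\<in>?f ` W. y \<noteq> z \<longrightarrow> k * \<rho> \<le> mdist m y z"
      using sep by auto
    ultimately have "finite (?f ` W) \<and> card (?f ` W) \<le> q" using q[of "k * \<rho>"] k \<rho> by simp
    then show ?thesis using inj by (simp add: card_image finite_image_iff)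
  qed
  then show ?thesis by blast
qed

text \<open>A cover of too small a sum is enlarged to open balls and reduced to a finite subcover.
  The stopping words at the scales of these balls whose images meet them form a cut set, so their
  weights sum to at least 1; but each ball contributes at most \<open>q\<close> times the power of
  its radius, and these add up to less than 1.\<close>

lemma hausdorff_measure_attractor_pos:
  assumes s: "(\<Sum>i<length S. c i powr s) = 1" and t: "0 < t" "t \<le> s"
    and dbl: "doubling m"
    and onto: "\<And>i. i < length S \<Longrightarrow> (S ! i) ` mspace m = mspace m"
    and osc: "open_set_condition m S"
  shows "0 < hausdorff_measure m t E"
proof -
  define A where "A = (\<lambda>\<rho> x. {w \<in> stopping \<rho>. S_word w ` E \<inter> mball x \<rho> \<noteq> {}})"
  obtain q0 :: nat where q0: "\<And>\<rho> x. 0 < \<rho> \<Longrightarrow> finite (A \<rho> x) \<and> card (A \<rho> x) \<le> q0"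
    using stopping_meeting_ball[OF dbl onto osc] unfolding A_def by blast
  \<comment> \<open>One is added so that \<open>q\<close> can be a denominator even if
    \<open>q0\<close> is 0.\<close>
  define q where "q = real q0 + 1"
  have q: "0 < q" by (simp add: q_def)
  have "ennreal (1 / (2 * q)) \<le> (\<Sum>n. ennreal (mdiameter m (U n) powr t))"
    if cover: "E \<subseteq> (\<Union>n. U n)" and UM: "\<And>n. U n \<subseteq> mspace m"
      and small: "\<And>n x y. x \<in> U n \<Longrightarrow> y \<in> U n \<Longrightarrow> mdist m x y \<le> 1 / 2" for U :: "nat \<Rightarrow> 'a set"
  proof (rule ccontr)
    assume "\<not> ?thesis"
    then have less: "(\<Sum>n. ennreal (mdiameter m (U n) powr t)) < ennreal (1 / (2 * q))" by simp
    define D where "D = (\<lambda>n. mdiameter m (U n))"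
    have D: "0 \<le> D n" "D n < 1" for n
      using mdiameter_nonneg[OF small] mdiameter_le[of "1/2" "U n" m] small[of _ n] by (force simp: D_def)+
    \<comment> \<open>The enlargement costs sum to at most \<open>1 / (2 * q)\<close>, which
      together with the assumed bound on the cover stays below \<open>1 / q\<close>. Radii below 1
      are required for stopping words to exist and for comparing the exponents \<open>s\<close> and
      \<open>t\<close>.\<close>
    have "\<exists>\<rho>. D n < \<rho> \<and> \<rho> < 1 \<and> \<rho> powr t < D n powr t + (1 / 2) ^ n / (4 * q)" for n
      using ex_powr_close_above[OF D t(1), where e = "(1 / 2) ^ n / (4 * q)"] q by simp
    then obtain \<rho> where \<rho>: "\<And>n. D n < \<rho> n" "\<And>n. \<rho> n < 1"
      "\<And>n. \<rho> n powr t < D n powr t + (1 / 2) ^ n / (4 * q)" by metis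
    have \<rho>0: "0 < \<rho> n" for n using D(1)[of n] \<rho>(1)[of n] by linarith
    \<comment> \<open>For empty \<open>U n\<close> the centre is arbitrary, and the inclusion in the
      ball is trivial.\<close>
    define x where "x = (\<lambda>n. SOME y. y \<in> U n)"
    have U_ball: "U n \<subseteq> mball (x n) (\<rho> n)" for n
    proof
      fix y assume y: "y \<in> U n"
      then have xU: "x n \<in> U n" unfolding x_def by (rule someI)
      have "mdist m (x n) y \<le> D n" unfolding D_def using small xU y by (rule mdist_le_mdiameter)
      with \<rho>(1)[of n] show "y \<in> mball (x n) (\<rho> n)" using xU y UM by auto
    qed
    have "compactin mtopology E"
      using is_attractor_compactin[OF is_attractor_attractor] by (simp add: mtopology_of_def)
    moreover have "E \<subseteq> \<Union> (range (\<lambda>n. mball (x n) (\<rho> n)))" using cover U_ball by blast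
    ultimately have "\<exists>\<F>. finite \<F> \<and> \<F> \<subseteq> range (\<lambda>n. mball (x n) (\<rho> n)) \<and> E \<subseteq> \<Union>\<F>"
      by (intro compactinD[of mtopology]) auto
    then obtain \<F> where \<F>: "finite \<F>" "\<F> \<subseteq> range (\<lambda>n. mball (x n) (\<rho> n))" "E \<subseteq> \<Union>\<F>"
      by (elim exE conjE)
    from finite_subset_image[OF \<F>(1,2)] obtain F where "finite F" "\<F> = (\<lambda>n. mball (x n) (\<rho> n)) ` F"
      by (elim exE conjE)
    with \<F>(3) have F: "finite F" "E \<subseteq> (\<Union>n\<in>F. mball (x n) (\<rho> n))" by simp_all
    define W where "W = (\<Union>n\<in>F. A (\<rho> n) (x n))"
    \<comment> \<open>Words of a common length \<open>N\<close> have ratio at most every radius of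
      the finite subcover, so they have a stopping prefix at each of these scales.\<close>
    have "\<exists>N. \<forall>n\<in>F. c_max ^ N \<le> \<rho> n"
    proof -
      have "\<forall>\<^sub>F N in sequentially. c_max ^ N \<le> \<rho> n" for n
        using order_tendstoD(2)[OF LIMSEQ_realpow_zero \<rho>0, of c_max n] c_max_bounds
        by (auto elim: eventually_mono)
      then have "\<forall>\<^sub>F N in sequentially. \<forall>n\<in>F. c_max ^ N \<le> \<rho> n"
        using F(1) by (intro eventually_ball_finite) auto
      then show ?thesis by (auto simp: eventually_sequentially)
    qed
    then obtain N where N: "\<And>n. n \<in> F \<Longrightarrow> c_max ^ N \<le> \<rho> n" by blast
    obtain y where y: "y \<in> E" using E_nonempty by blast
    \<comment> \<open>The point \<open>S_word w y\<close> lies in some ball of the subcover. The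
      stopping prefix of \<open>w\<close> at the scale of that ball has an image containing the same
      point, so it is counted in \<open>W\<close>.\<close>
    have cut: "\<exists>v\<in>W. prefix v w" if w: "w \<in> words_of N" for w
    proof -
      have ww: "w \<in> words" using w by simp
      have "S_word w y \<in> E" using is_attractor_word_image[OF is_attractor_attractor] ww y by blast
      then obtain n where n: "n \<in> F" "S_word w y \<in> mball (x n) (\<rho> n)" using F(2) by blast
      have "c_word w \<le> \<rho> n" using c_word_le[OF ww] w N[OF n(1)] by auto
      then obtain v where v: "v \<in> stopping (\<rho> n)" "prefix v w"
        using ex_stopping_prefix[OF \<rho>(2) ww] by blast
      then obtain u where u: "w = v @ u" by (auto simp: prefix_def)
      then have "S_word u y \<in> E"
        using is_attractor_word_image[OF is_attractor_attractor] ww y by auto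
      moreover have "S_word v (S_word u y) \<in> mball (x n) (\<rho> n)" using n u by (simp add: S_word_append)
      ultimately have "v \<in> A (\<rho> n) (x n)" using v unfolding A_def by blast
      then show ?thesis using n v unfolding W_def by blast
    qed
    have finA: "finite (A (\<rho> n) (x n))" "card (A (\<rho> n) (x n)) \<le> q0" for n using q0[OF \<rho>0] by auto
    have "1 \<le> (\<Sum>v\<in>W. c_word v powr s)"
    proof (rule cut_set_sum[OF s _ _ cut])
      show "finite W" unfolding W_def using F(1) finA by blast
      show "W \<subseteq> words" unfolding W_def A_def using stopping_words by blast
    qed
    also have "\<dots> \<le> (\<Sum>n\<in>F. \<Sum>v\<in>A (\<rho> n) (x n). c_word v powr s)"
      unfolding W_def
    proof -
      \<comment> \<open>A word may be counted for several balls, so the sum over the union is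
        compared with the sum over the disjoint union.\<close>
      have "(\<Sum>v\<in>(\<Union>n\<in>F. A (\<rho> n) (x n)). c_word v powr s)
          = (\<Sum>v\<in>snd ` (SIGMA n:F. A (\<rho> n) (x n)). c_word v powr s)"
        by (intro sum.cong) force+
      also have "\<dots> \<le> (\<Sum>p\<in>(SIGMA n:F. A (\<rho> n) (x n)). c_word (snd p) powr s)"
        using sum_image_le[of "SIGMA n:F. A (\<rho> n) (x n)" "\<lambda>v. c_word v powr s" snd] F(1) finA by simp
      also have "\<dots> = (\<Sum>n\<in>F. \<Sum>v\<in>A (\<rho> n) (x n). c_word v powr s)"
        using F(1) finA by (simp add: sum.Sigma case_prod_beta)
      finally show "(\<Sum>v\<in>(\<Union>n\<in>F. A (\<rho> n) (x n)). c_word v powr s)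
          \<le> (\<Sum>n\<in>F. \<Sum>v\<in>A (\<rho> n) (x n). c_word v powr s)" .
    qed
    also have "\<dots> \<le> (\<Sum>n\<in>F. q * \<rho> n powr t)"
    proof (rule sum_mono)
      fix n assume "n \<in> F"
      have "c_word v powr s \<le> \<rho> n powr t" if "v \<in> A (\<rho> n) (x n)" for v
      proof -
        have v: "v \<in> words" "c_word v \<le> \<rho> n" using that by (auto simp: A_def stopping_def)
        have "c_word v powr s \<le> \<rho> n powr s"
          using v c_word_pos[of v] t by (intro powr_mono2) auto
        also have "\<dots> \<le> \<rho> n powr t" using t \<rho>0[of n] \<rho>(2)[of n] by (intro powr_mono') auto
        finally show ?thesis .
      qed
      then have "(\<Sum>v\<in>A (\<rho> n) (x n). c_word v powr s) \<le> of_nat (card (A (\<rho> n) (x n))) * \<rho> n powr t"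
        by (rule sum_bounded_above)
      also have "\<dots> \<le> q * \<rho> n powr t"
        using finA(2)[of n] by (intro mult_right_mono) (auto simp: q_def)
      finally show "(\<Sum>v\<in>A (\<rho> n) (x n). c_word v powr s) \<le> q * \<rho> n powr t" .
    qed
    also have "\<dots> \<le> (\<Sum>n\<in>F. q * (D n powr t + (1 / 2) ^ n / (4 * q)))"
      using \<rho>(3) q by (intro sum_mono mult_left_mono) (auto intro: less_imp_le)
    also have "\<dots> = q * (\<Sum>n\<in>F. D n powr t) + (\<Sum>n\<in>F. (1 / 2) ^ n) / 4"
      using q by (simp add: distrib_left sum.distrib sum_distrib_left sum_divide_distrib)
    also have "\<dots> < q * (1 / (2 * q)) + 2 / 4"
    proof (rule add_less_le_mono)
      have "ennreal (\<Sum>n\<in>F. D n powr t) = (\<Sum>n\<in>F. ennreal (D n powr t))" by simp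
      also have "\<dots> \<le> (\<Sum>n. ennreal (D n powr t))" using F(1) by (intro sum_le_suminf) auto
      also have "\<dots> < ennreal (1 / (2 * q))" using less by (simp add: D_def)
      finally have "(\<Sum>n\<in>F. D n powr t) < 1 / (2 * q)"
        by (subst (asm) ennreal_less_iff) (auto intro: sum_nonneg)
      then show "q * (\<Sum>n\<in>F. D n powr t) < q * (1 / (2 * q))" using q by (intro mult_strict_left_mono)
      have "(\<Sum>n\<in>F. (1 / 2 :: real) ^ n) \<le> (\<Sum>n. (1 / 2) ^ n)"
        using F(1) by (intro sum_le_suminf) auto
      then show "(\<Sum>n\<in>F. (1 / 2 :: real) ^ n) / 4 \<le> 2 / 4" by (simp add: suminf_geometric)
    qed
    also have "\<dots> = 1" using q by simp
    finally show False by simp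
  qed
  then have "ennreal (1 / (2 * q)) \<le> hausdorff_content m t (1 / 2) E"
    unfolding hausdorff_content_def by (intro INF_greatest) blast
  also have "\<dots> \<le> hausdorff_measure m t E"
    unfolding hausdorff_measure_def by (rule SUP_upper) simp
  finally show ?thesis using q by (auto simp: ennreal_zero_less_divide elim!: less_le_trans[rotated])
qed

text \<open>Moran's theorem. For \<open>t > s\<close> the sum of the powers of the ratios drops
  below 1 and the measure vanishes; for \<open>0 < t \<le> s\<close> it is positive.\<close>

theorem hausdorff_dim_attractor:
  assumes s: "0 < s" "(\<Sum>i<length S. c i powr s) = 1"
    and dbl: "doubling m"
    and onto: "\<And>i. i < length S \<Longrightarrow> (S ! i) ` mspace m = mspace m"
    and osc: "open_set_condition m S"
  shows "hausdorff_dim m E = ereal s"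
proof -
  have "{t. 0 < t \<and> hausdorff_measure m t E = 0} = {s<..}"
  proof (intro equalityI subsetI)
    fix t assume t: "t \<in> {t. 0 < t \<and> hausdorff_measure m t E = 0}"
    show "t \<in> {s<..}"
    proof (rule ccontr)
      assume "t \<notin> {s<..}"
      with t have "0 < hausdorff_measure m t E"
        by (intro hausdorff_measure_attractor_pos[OF s(2) _ _ dbl onto osc]) auto
      with t show False by simp
    qed
  next
    fix t assume t: "t \<in> {s<..}"
    have "(\<Sum>i<length S. c i powr t) < (\<Sum>i<length S. c i powr s)"
      using t c_pos c_less_1 S_nonempty by (intro sum_strict_mono powr_less_mono') auto
    with s t show "t \<in> {t. 0 < t \<and> hausdorff_measure m t E = 0}"
      using hausdorff_measure_attractor_eq_0[of t] by simp
  qed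
  moreover have "(INF t\<in>{s<..}. ereal t) = ereal s"
  proof (rule antisym)
    show "(INF t\<in>{s<..}. ereal t) \<le> ereal s"
    proof (rule ereal_le_epsilon2)
      fix e :: real assume "0 < e"
      then show "(INF t\<in>{s<..}. ereal t) \<le> ereal s + ereal e"
        by (intro INF_lower2[of "s + e"]) auto
    qed
  qed (auto intro!: INF_greatest)
  ultimately show ?thesis unfolding hausdorff_dim_def by simp
qed

end

lemma hausdorff_dim_attractor_euclid:
  assumes "S \<noteq> []" "\<And>i. i < length S \<Longrightarrow> contracting_similarity (euclid d) (c i) (S ! i)"
    and "open_set_condition (euclid d) S" "0 < s" "(\<Sum>i<length S. c i powr s) = 1"
  shows "hausdorff_dim (euclid d) (attractor (euclid d) S) = ereal s"
proof -
  interpret similarity_system "euclid d" S c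
  proof
    show "mspace (euclid d) \<noteq> {}" by (auto intro!: exI[of _ "\<lambda>_. 0"])
  qed (use assms compactin_euclid_mcball in auto)
  show ?thesis
    using assms contracting_similarity_euclid_onto
    by (intro hausdorff_dim_attractor doubling_euclid) blast+
qed

section \<open>The roots of an iterated function system\<close>

lemma contracting_similarity_ratio_unique:
  assumes "contracting_similarity m c f" "contracting_similarity m c' f"
    and "x \<in> mspace m" "y \<in> mspace m" "x \<noteq> y"
  shows "c = c'"
proof -
  have "c * mdist m x y = c' * mdist m x y"
    using assms unfolding contracting_similarity_def by metis
  then show ?thesis using assms by simp
qed

text \<open>Taking logarithms of \<open>r ^ l i = r' ^ l' i\<close> shows that the exponent vectors
  are proportional. Both have greatest common divisor 1, so they agree at index 0, and then so do
  the bases. The two distinct points make the ratio of each map unique.\<close>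

lemma is_ratio_root_unique:
  assumes r: "is_ratio_root m S r" and r': "is_ratio_root m S r'"
    and S: "S \<noteq> []" and xy: "x \<in> mspace m" "y \<in> mspace m" "x \<noteq> y"
  shows "r = r'"
proof -
  obtain l l' :: "nat \<Rightarrow> nat" where
    l: "\<And>i. i < length S \<Longrightarrow> 0 < l i \<and> contracting_similarity m (r ^ l i) (S ! i)" "Gcd (l ` {..<length S}) = 1"
    and l': "\<And>i. i < length S \<Longrightarrow> 0 < l' i \<and> contracting_similarity m (r' ^ l' i) (S ! i)" "Gcd (l' ` {..<length S}) = 1"
    and r01: "0 < r" "r < 1" "0 < r'" "r' < 1"
    using r r' unfolding is_ratio_root_def by blast
  have eq: "r ^ l i = r' ^ l' i" if "i < length S" for i
    using contracting_similarity_ratio_unique[OF conjunct2[OF l(1)[OF that]] conjunct2[OF l'(1)[OF that]] xy] .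
  have ln: "real (l i) * ln r = real (l' i) * ln r'" if "i < length S" for i
    using arg_cong[OF eq[OF that], of ln] r01 by (simp add: ln_realpow)
  have S0: "0 < length S" using S by simp
  have cross: "l' 0 * l i = l 0 * l' i" if "i < length S" for i
  proof -
    have "(real (l' 0) * real (l i)) * (ln r * ln r') = (real (l i) * ln r) * (real (l' 0) * ln r')"
      by (simp add: ac_simps)
    also have "\<dots> = (real (l' i) * ln r') * (real (l 0) * ln r)" using ln[OF that] ln[OF S0] by simp
    also have "\<dots> = (real (l 0) * real (l' i)) * (ln r * ln r')" by (simp add: ac_simps)
    finally have "real (l' 0) * real (l i) = real (l 0) * real (l' i)" using r01 by simp
    then show ?thesis by (metis of_nat_eq_iff of_nat_mult)
  qed
  have "l' 0 * Gcd (l ` {..<length S}) = Gcd ((*) (l' 0) ` l ` {..<length S})" by (simp add: Gcd_mult)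
  also have "(*) (l' 0) ` l ` {..<length S} = (*) (l 0) ` l' ` {..<length S}"
    unfolding image_image using cross by (intro image_cong) auto
  also have "Gcd \<dots> = l 0 * Gcd (l' ` {..<length S})" by (simp add: Gcd_mult)
  finally have "l' 0 = l 0" using l(2) l'(2) by simp
  then have "r ^ l 0 = r' ^ l 0" using eq[OF S0] by simp
  then show ?thesis using l(1)[OF S0] r01 by (simp add: power_eq_iff_eq_base)
qed

text \<open>With \<open>s = ln p / ln r\<close> one has \<open>r powr s = p\<close>, which turns the
  equation for \<open>p\<close> into Moran's equation for the ratios \<open>r ^ l i\<close>. So
  \<open>s\<close> is the dimension and \<open>p\<close> the measure root.\<close>

lemma measure_root_euclid:
  assumes d: "1 \<le> d" and S: "2 \<le> length S" and r: "0 < r" "r < 1" and p: "0 < p" "p < 1"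
    and l: "\<And>i. i < length S \<Longrightarrow> 0 < l i"
      "\<And>i. i < length S \<Longrightarrow> contracting_similarity (euclid d) (r ^ l i) (S ! i)"
      "Gcd (l ` {..<length S}) = 1"
    and osc: "open_set_condition (euclid d) S"
    and sum: "(\<Sum>i<length S. p ^ l i) = 1"
  shows "ratio_root (euclid d) S = r" "measure_root (euclid d) S = p"
proof -
  have root: "is_ratio_root (euclid d) S r" using r l unfolding is_ratio_root_def by blast
  have "S \<noteq> []" using S by auto
  \<comment> \<open>The origin and the first unit vector, which belongs to the space because
    \<open>1 \<le> d\<close>.\<close>
  have xy: "(\<lambda>_. 0) \<in> mspace (euclid d)" "(\<lambda>i. if i = 0 then 1 else 0) \<in> mspace (euclid d)"
    "(\<lambda>_. 0) \<noteq> (\<lambda>i::nat. if i = 0 then 1 else 0 :: real)"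
    using d by (auto simp: fun_eq_iff)
  show ratio: "ratio_root (euclid d) S = r"
    unfolding ratio_root_def using root is_ratio_root_unique[OF _ root \<open>S \<noteq> []\<close> xy] by (rule the_equality)
  define s where "s = ln p / ln r"
  have s: "0 < s" using r p by (simp add: s_def divide_neg_neg)
  have rs: "r powr s = p" using r p by (simp add: s_def powr_def)
  have "(r ^ n) powr s = p ^ n" for n
  proof -
    have "(r ^ n) powr s = (r powr s) powr real n"
      using r by (simp add: powr_realpow[symmetric] powr_powr mult.commute)
    then show ?thesis using p by (simp add: rs powr_realpow)
  qed
  then have "(\<Sum>i<length S. (r ^ l i) powr s) = 1" using sum by simp
  then have "hausdorff_dim (euclid d) (attractor (euclid d) S) = ereal s"
    using \<open>S \<noteq> []\<close> l(2) osc s by (intro hausdorff_dim_attractor_euclid) auto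
  then show "measure_root (euclid d) S = p" unfolding measure_root_def ratio by (simp add: rs)
qed

text \<open>Intermediate values: the sum is 0 at 0 and at least 2 at 1.\<close>

lemma ex_root_sum_powers:
  fixes l :: "nat \<Rightarrow> nat"
  assumes "2 \<le> n" "\<And>i. i < n \<Longrightarrow> 0 < l i"
  shows "\<exists>p::real. 0 < p \<and> p < 1 \<and> (\<Sum>i<n. p ^ l i) = 1"
proof -
  define f where "f = (\<lambda>p::real. \<Sum>i<n. p ^ l i)"
  have f: "f 0 = 0" "f 1 = real n" using assms by (simp_all add: f_def zero_power)
  have "\<exists>p\<ge>0. p \<le> 1 \<and> f p = 1"
  proof (rule IVT')
    show "continuous_on {0..1} f" unfolding f_def by (intro continuous_intros)
  qed (use f assms in auto)
  then obtain p where p: "0 \<le> p" "p \<le> 1" "f p = 1" by blast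
  then have "p \<noteq> 0" "p \<noteq> 1" using f assms by auto
  with p show ?thesis unfolding f_def by (intro exI[of _ p]) auto
qed

section \<open>Systems with prescribed roots\<close>

text \<open>
  The cyclic shift of coordinates followed by scaling with \<open>r\<close> maps the box with sides
  \<open>1, r, \<dots>, r^(d - 1)\<close> onto its slab of thickness \<open>r^d\<close> in direction \<open>0\<close>. So a similarity of ratio
  \<open>r^n\<close> with \<open>n > 0\<close> needs only a fraction \<open>r^d\<close> of one side, however close \<open>r\<close> is to \<open>1\<close>.
\<close>

definition twist :: "nat \<Rightarrow> real \<Rightarrow> (nat \<Rightarrow> real) \<Rightarrow> nat \<Rightarrow> real" where
  "twist d r x = (\<lambda>i. if d \<le> i then 0 else if i = 0 then r * x (d - 1) else r * x (i - 1))"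

text \<open>The relation \<open>R\<close> is \<open>(<)\<close> for the open box and \<open>(\<le>)\<close> for the closed one.\<close>

definition brick :: "(real \<Rightarrow> real \<Rightarrow> bool) \<Rightarrow> nat \<Rightarrow> real \<Rightarrow> (nat \<Rightarrow> real) set" where
  "brick R d r = {x \<in> mspace (euclid d). \<forall>i<d. R 0 (x i) \<and> R (x i) (r ^ i)}"

definition slab_map :: "nat \<Rightarrow> real \<Rightarrow> nat \<Rightarrow> real \<Rightarrow> (nat \<Rightarrow> real) \<Rightarrow> nat \<Rightarrow> real" where
  "slab_map d r n a x = (let y = (twist d r ^^ n) x in y(0 := y 0 + a))"

lemma twist_mspace: "twist d r x \<in> mspace (euclid d)"
  by (simp add: twist_def)

lemma twist_mdist:
  assumes "0 < d" "0 < r"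
  shows "mdist (euclid d) (twist d r x) (twist d r y) = r * mdist (euclid d) x y"
proof -
  obtain e where d: "d = Suc e" using assms gr0_implies_Suc by blast
  \<comment> \<open>Index 0 of the twisted point carries coordinate \<open>e\<close>, and index
    \<open>Suc i\<close> carries coordinate \<open>i\<close>.\<close>
  have "(\<Sum>i<d. (twist d r x i - twist d r y i)\<^sup>2) = (\<Sum>i<d. (r * (x i - y i))\<^sup>2)"
    unfolding d by (subst sum.lessThan_Suc_shift, simp add: twist_def right_diff_distrib)
  then have "mdist (euclid d) (twist d r x) (twist d r y) = L2_set (\<lambda>i. r * (x i - y i)) {..<d}"
    by (simp add: mdist_euclid L2_set_def)
  then show ?thesis using assms by (simp add: mdist_euclid L2_set_right_distrib)
qed

lemma slab_map_similarity:
  assumes "0 < d" "0 < r" "r < 1" "0 < n"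
  shows "contracting_similarity (euclid d) (r ^ n) (slab_map d r n a)"
proof -
  have maps: "(twist d r ^^ n) x \<in> mspace (euclid d)" if "0 < n" for x n
    using that twist_mspace by (cases n) auto
  have "slab_map d r n a x \<in> mspace (euclid d)" for x
    using maps[OF assms(4), of x] assms(1) by (simp add: slab_map_def Let_def)
  moreover have "mdist (euclid d) ((twist d r ^^ n) x) ((twist d r ^^ n) y) = r ^ n * mdist (euclid d) x y" for x y n
    by (induction n) (simp_all add: twist_mdist assms)
  moreover have "mdist (euclid d) (slab_map d r n a x) (slab_map d r n a y)
      = mdist (euclid d) ((twist d r ^^ n) x) ((twist d r ^^ n) y)" for x y
    unfolding mdist_euclid slab_map_def Let_def by (rule arg_cong2[where f = L2_set]) auto
  ultimately show ?thesis
    using assms by (simp add: contracting_similarity_def power_less_one_iff del: mspace_euclid)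
qed

text \<open>The side \<open>r ^ i\<close> scales to \<open>r ^ Suc i\<close>, exactly the next side,
  and the last side scales to \<open>r ^ d\<close>, which is less than the first side 1.\<close>

lemma twist_brick:
  assumes R: "R = (<) \<or> R = (\<le>)" and r: "0 < r" "r < 1" and "0 < d" and x: "x \<in> brick R d r"
  shows "twist d r x \<in> brick R d r" "twist d r x 0 \<le> r ^ d"
proof -
  obtain e where d: "d = Suc e" using assms gr0_implies_Suc by blast
  have xi: "R 0 (x i)" "R (x i) (r ^ i)" if "i < d" for i using x that by (auto simp: brick_def)
  have scale: "R a b \<Longrightarrow> R (r * a) (r * b)" for a b using R r by auto
  have 0: "R 0 (r * x e)" "R (r * x e) (r ^ d)"
    using scale[OF xi(1), of e] scale[OF xi(2), of e] d by auto
  moreover have "r ^ d < 1" using r assms(4) by (simp add: power_less_one_iff)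
  ultimately have "R (r * x e) 1" using R by auto
  moreover have "R 0 (r * x i)" "R (r * x i) (r ^ Suc i)" if "i < d" for i
    using scale[OF xi(1)[OF that]] scale[OF xi(2)[OF that]] by auto
  ultimately have "R 0 (twist d r x i) \<and> R (twist d r x i) (r ^ i)" if "i < d" for i
    using that 0(1) d by (cases i) (auto simp: twist_def)
  then show "twist d r x \<in> brick R d r" using twist_mspace unfolding brick_def by blast
  show "twist d r x 0 \<le> r ^ d" using 0(2) R d by (auto simp: twist_def)
qed

text \<open>All iterates of the twist stay in the brick, and the last one brings the point into the
  slab of thickness \<open>r ^ d\<close>; the translation by \<open>a\<close> then still ends below
  1.\<close>

lemma slab_map_brick:
  assumes R: "R = (<) \<or> R = (\<le>)" and r: "0 < r" "r < 1" and d: "0 < d" and n: "0 < n"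
    and a: "0 \<le> a" "a + r ^ d < 1" and x: "x \<in> brick R d r"
  shows "slab_map d r n a x \<in> brick R d r" "a \<le> slab_map d r n a x 0" "slab_map d r n a x 0 \<le> a + r ^ d"
proof -
  define y where "y = (twist d r ^^ n) x"
  have it: "(twist d r ^^ k) x \<in> brick R d r" for k
    by (induction k) (simp_all add: x twist_brick[OF R r d])
  obtain k where "n = Suc k" using n gr0_implies_Suc by blast
  then have y: "y \<in> brick R d r" "y 0 \<le> r ^ d"
    using it[of n] twist_brick(2)[OF R r d it[of k]] by (auto simp: y_def)
  have y0: "R 0 (y 0)" using y(1) d by (auto simp: brick_def)
  have map: "slab_map d r n a x = y(0 := y 0 + a)" by (simp add: slab_map_def y_def Let_def)
  have "R 0 (y 0 + a)" "R (y 0 + a) 1" using y0 y(2) a R by auto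
  then show "slab_map d r n a x \<in> brick R d r"
    using y(1) d unfolding map brick_def by auto
  show "a \<le> slab_map d r n a x 0" "slab_map d r n a x 0 \<le> a + r ^ d"
    using y0 y(2) R unfolding map by auto
qed

section \<open>Topology of the bricks and disjointness of their images\<close>

lemma continuous_map_coordinate_euclid:
  assumes "i < d" shows "continuous_map (mtopology_of (euclid d)) euclideanreal (\<lambda>x. x i)"
proof -
  have "Lipschitz_continuous_map (euclid d) euclidean_metric (\<lambda>x. x i)"
    unfolding Lipschitz_continuous_map_def
    using abs_le_mdist_euclid[OF assms] by (auto intro!: exI[of _ 1] simp: dist_real_def)
  from Lipschitz_continuous_imp_continuous_map[OF this] show ?thesis by simp
qed

lemma openin_brick:
  assumes "0 < d" shows "openin (mtopology_of (euclid d)) (brick (<) d r)"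
proof -
  let ?X = "mtopology_of (euclid d)"
  have "brick (<) d r = (\<Inter>i\<in>{..<d}. {x \<in> topspace ?X. x i \<in> {0<..<r ^ i}})"
    using assms by (auto simp: brick_def)
  moreover have "openin ?X {x \<in> topspace ?X. x i \<in> {0<..<r ^ i}}" if "i < d" for i
    by (rule openin_continuous_map_preimage[OF continuous_map_coordinate_euclid[OF that]]) simp
  ultimately show ?thesis using assms by (auto intro!: openin_Inter)
qed

lemma closedin_brick:
  assumes "0 < d" shows "closedin (mtopology_of (euclid d)) (brick (\<le>) d r)"
proof -
  let ?X = "mtopology_of (euclid d)"
  have "brick (\<le>) d r = (\<Inter>i\<in>{..<d}. {x \<in> topspace ?X. x i \<in> {0..r ^ i}})"
    using assms by (auto simp: brick_def)
  moreover have "closedin ?X {x \<in> topspace ?X. x i \<in> {0..r ^ i}}" if "i < d" for i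
    by (rule closedin_continuous_map_preimage[OF continuous_map_coordinate_euclid[OF that]]) simp
  ultimately show ?thesis using assms by (auto intro!: closedin_Inter)
qed

lemma mbounded_brick:
  assumes "0 < r" "r < 1"
  shows "Metric_space.mbounded (mspace (euclid d)) (mdist (euclid d)) (brick (<) d r)"
proof -
  interpret Metric_space "mspace (euclid d)" "mdist (euclid d)" by (rule Metric_space_mspace_mdist)
  have "x \<in> mcball (\<lambda>_. 0) (real (Suc d))" if x: "x \<in> brick (<) d r" for x
  proof -
    have "\<bar>0 - x i\<bar> < real (Suc d) / real (Suc d)" if "i < d" for i
    proof -
      have "0 < x i" "x i < r ^ i" using x that by (auto simp: brick_def)
      moreover have "r ^ i \<le> 1" using assms by (simp add: power_le_one)
      ultimately show ?thesis by simp
    qed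
    then have "mdist (euclid d) (\<lambda>_. 0) x < real (Suc d)" by (intro mdist_euclid_less) auto
    moreover have "x \<in> mspace (euclid d)" "(\<lambda>_. 0) \<in> mspace (euclid d)" using x by (simp_all add: brick_def)
    ultimately show ?thesis by (simp del: mspace_euclid)
  qed
  then show ?thesis unfolding mbounded_def by blast
qed

text \<open>With \<open>t = r ^ d\<close>, coordinate 0 of the image with index \<open>i\<close>
  lies between \<open>2 * i * t\<close> and \<open>(2 * i + 1) * t\<close>, so consecutive slabs
  leave gaps of length \<open>t\<close>.\<close>

lemma disjnt_slab_images:
  assumes R: "R = (<) \<or> R = (\<le>)" and r: "0 < r" "r < 1" and d: "0 < d" and N: "2 * real N * r ^ d < 1"
    and ij: "i < N" "j < N" "i \<noteq> j" and n: "0 < n" "0 < n'"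
  shows "disjnt (slab_map d r n (2 * real i * r ^ d) ` brick R d r) (slab_map d r n' (2 * real j * r ^ d) ` brick R d r)"
proof -
  define t where "t = r ^ d"
  have t: "0 < t" using r by (simp add: t_def)
  have a: "0 \<le> 2 * real k * t" "2 * real k * t + t < 1" if "k < N" for k
  proof -
    have "(2 * real k + 1) * t \<le> 2 * real N * t" using that t by (intro mult_right_mono) auto
    then show "2 * real k * t + t < 1" using N by (simp add: t_def algebra_simps)
  qed (use t in simp)
  have False if x: "x \<in> brick R d r" and y: "y \<in> brick R d r"
    and eq: "slab_map d r n (2 * real i * t) x = slab_map d r n' (2 * real j * t) y" for x y
  proof -
    note sx = slab_map_brick(2,3)[OF R r d n(1) a[OF ij(1), unfolded t_def] x, folded t_def]
    note sy = slab_map_brick(2,3)[OF R r d n(2) a[OF ij(2), unfolded t_def] y, folded t_def]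
    have gap: "2 * real k * t + t < 2 * real k' * t" if "k < k'" for k k'
    proof -
      have "(2 * real k + 1) * t < (2 * real k') * t" using that t by (intro mult_strict_right_mono) auto
      then show ?thesis by (simp add: algebra_simps)
    qed
    from \<open>i \<noteq> j\<close> consider "i < j" | "j < i" by linarith
    then show False using gap[of i j] gap[of j i] sx sy eq by cases auto
  qed
  then show ?thesis unfolding disjnt_iff t_def by blast
qed

text \<open>The open brick witnesses the open set condition. The closed brick contains the
  attractor, and its images are disjoint, which gives total disconnectedness.\<close>

lemma TDC_OSC1E_roots_nonempty:
  fixes l :: "nat \<Rightarrow> nat"
  assumes p: "0 < p" "p < 1" and r: "0 < r" "r < 1" and N: "2 \<le> N"
    and l: "\<And>i. i < N \<Longrightarrow> 0 < l i" "Gcd (l ` {..<N}) = 1" "(\<Sum>i<N. p ^ l i) = 1"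
  shows "TDC_OSC1E_roots p r \<noteq> {}"
proof -
  obtain e where e: "r ^ e < 1 / (2 * real N)"
    using real_arch_pow_inv[of "1 / (2 * real N)" r] r N by auto
  \<comment> \<open>The successor makes the dimension positive.\<close>
  define d where "d = Suc e"
  have "r ^ d \<le> r ^ e" using r unfolding d_def by (intro power_decreasing) auto
  then have "2 * real N * r ^ d \<le> 2 * real N * r ^ e" by (intro mult_left_mono) auto
  also have "\<dots> < 1" using e N by (simp add: field_simps)
  finally have t: "2 * real N * r ^ d < 1" .
  have d: "0 < d" by (simp add: d_def)
  define a where "a = (\<lambda>i. 2 * real i * r ^ d)"
  define S where "S = map (\<lambda>i. slab_map d r (l i) (a i)) [0..<N]"
  have len: "length S = N" and nth: "\<And>i. i < N \<Longrightarrow> S ! i = slab_map d r (l i) (a i)"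
    by (simp_all add: S_def)
  have a: "0 \<le> a i" "a i + r ^ d < 1" if "i < N" for i
  proof -
    have "(2 * real i + 1) * r ^ d \<le> 2 * real N * r ^ d" using that r by (intro mult_right_mono) auto
    then show "a i + r ^ d < 1" using t by (simp add: a_def algebra_simps)
  qed (use r in \<open>simp add: a_def\<close>)
  have sim: "contracting_similarity (euclid d) (r ^ l i) (S ! i)" if "i < length S" for i
    using that len slab_map_similarity[OF d r] l(1) by (simp add: nth)
  have sub: "(S ! i) ` brick R d r \<subseteq> brick R d r" if "i < length S" "R = (<) \<or> R = (\<le>)" for i R
    using slab_map_brick(1)[OF that(2) r d] l(1) a that(1) len by (auto simp: nth)
  have disj: "disjnt ((S ! i) ` brick R d r) ((S ! j) ` brick R d r)"
    if "i < length S" "j < length S" "i \<noteq> j" "R = (<) \<or> R = (\<le>)" for i j R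
    using disjnt_slab_images[OF that(4) r d t _ _ that(3)] that len l(1) by (simp add: nth a_def)
  have mid: "(\<lambda>i. if i < d then r ^ i / 2 else 0) \<in> brick R d r" if "R = (<) \<or> R = (\<le>)" for R
    using that r by (auto simp: brick_def)
  have ne: "brick R d r \<noteq> {}" if "R = (<) \<or> R = (\<le>)" for R using mid[OF that] by blast
  interpret similarity_system "euclid d" S "\<lambda>i. r ^ l i"
  proof
    show "mspace (euclid d) \<noteq> {}" by (auto intro!: exI[of _ "\<lambda>_. 0"])
    show "S \<noteq> []" using len N by auto
  qed (use sim compactin_euclid_mcball in auto)
  have E: "attractor (euclid d) S \<subseteq> brick (\<le>) d r"
    by (rule is_attractor_subset_invariant[OF is_attractor_attractor closedin_brick[OF d] ne sub]) auto
  have "mtotally_disconnected (euclid d) (attractor (euclid d) S)"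
  proof (rule mtotally_disconnected_attractor)
    fix i j assume "i < length S" "j < length S" "i \<noteq> j"
    then have "disjnt ((S ! i) ` brick (\<le>) d r) ((S ! j) ` brick (\<le>) d r)" by (intro disj) auto
    then show "disjnt ((S ! i) ` attractor (euclid d) S) ((S ! j) ` attractor (euclid d) S)"
      by (rule disjnt_subset1[OF disjnt_subset2[OF _ image_mono[OF E]] image_mono[OF E]])
  qed
  moreover have osc: "open_set_condition (euclid d) S"
    unfolding open_set_condition_def
    by (intro exI[of _ "brick (<) d r"] conjI allI impI openin_brick mbounded_brick ne sub disj d r) simp_all
  moreover have "commensurable (euclid d) S"
    unfolding commensurable_def is_ratio_root_def
    using l len by (intro exI[of _ r] conjI exI[of _ l] allI impI r sim) simp_all
  moreover have "IFS (euclid d) S"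
    unfolding IFS_def
  proof (intro conjI ballI)
    fix f assume "f \<in> set S"
    then obtain i where "i < length S" "f = S ! i" by (auto simp: in_set_conv_nth)
    with sim[of i] show "\<exists>c. contracting_similarity (euclid d) c f" by blast
  qed (use N len in simp)
  ultimately have "(d, S) \<in> TDC_OSC1E" using d by (simp add: TDC_OSC1E_def)
  moreover have "ratio_root (euclid d) S = r" "measure_root (euclid d) S = p"
    using measure_root_euclid[OF _ _ r p _ sim _ osc] d N l by (simp_all add: len)
  ultimately show ?thesis unfolding TDC_OSC1E_roots_def by blast
qed

text \<open>The exponents are those of commensurability. The root \<open>q\<close> of their power
  sum is identified with the measure root by computing both roots of the system.\<close>

lemma TDC_OSC1E_roots_ex:
  assumes "TDC_OSC1E_roots p r \<noteq> {}"
  shows "0 < p \<and> p < 1 \<and> 0 < r \<and> r < 1 \<and> (\<exists>(N :: nat) (l :: nat \<Rightarrow> nat).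
    (\<forall>i<N. 0 < l i) \<and> Gcd (l ` {..<N}) = 1 \<and> (\<Sum>i<N. p ^ l i) = 1)"
proof -
  obtain d S where d: "1 \<le> d" and S: "IFS (euclid d) S" "open_set_condition (euclid d) S"
      "commensurable (euclid d) S"
    and p: "measure_root (euclid d) S = p" and r: "ratio_root (euclid d) S = r"
    using assms unfolding TDC_OSC1E_roots_def TDC_OSC1E_def by blast
  obtain r' and l :: "nat \<Rightarrow> nat" where r': "0 < r'" "r' < 1"
    and l: "\<And>i. i < length S \<Longrightarrow> 0 < l i"
      "\<And>i. i < length S \<Longrightarrow> contracting_similarity (euclid d) (r' ^ l i) (S ! i)"
      "Gcd (l ` {..<length S}) = 1"
    using S(3) unfolding commensurable_def is_ratio_root_def by metis
  have N: "2 \<le> length S" using S(1) by (simp add: IFS_def)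
  obtain q :: real where q: "0 < q" "q < 1" "(\<Sum>i<length S. q ^ l i) = 1"
    using ex_root_sum_powers[OF N, of l] l(1) by blast
  from measure_root_euclid[OF d N r' q(1,2) l S(2) q(3)] p r have "r' = r" "q = p" by simp_all
  with q r' l show ?thesis by (intro conjI exI[of _ "length S"] exI[of _ l]) auto
qed

theorem proposition1p1:
  fixes p r :: real
  shows "TDC_OSC1E_roots p r \<noteq> {} \<longleftrightarrow>
    0 < p \<and> p < 1 \<and> 0 < r \<and> r < 1 \<and>
    (\<exists>(N :: nat) (l :: nat \<Rightarrow> nat). (\<forall>i\<in>{1..N}. 0 < l i) \<and> Gcd (l ` {1..N}) = 1 \<and>
      (\<Sum>i=1..N. p ^ l i) = 1)"
proof
  assume "TDC_OSC1E_roots p r \<noteq> {}"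
  from TDC_OSC1E_roots_ex[OF this] obtain N and l :: "nat \<Rightarrow> nat" where
    pr: "0 < p" "p < 1" "0 < r" "r < 1"
    and l: "\<forall>i<N. 0 < l i" "Gcd (l ` {..<N}) = 1" "(\<Sum>i<N. p ^ l i) = 1"
    by blast
  \<comment> \<open>Moves the exponents from the indices below \<open>N\<close> to the indices from
    1 to \<open>N\<close>.\<close>
  define l' where "l' = (\<lambda>i. l (i - 1))"
  have shift: "{1..N} = Suc ` {..<N}" by (simp add: image_Suc_lessThan)
  have "\<forall>i\<in>{1..N}. 0 < l' i" "Gcd (l' ` {1..N}) = 1" "(\<Sum>i=1..N. p ^ l' i) = 1"
    unfolding shift using l by (simp_all add: l'_def image_image sum.reindex)
  with pr show "0 < p \<and> p < 1 \<and> 0 < r \<and> r < 1 \<and>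
    (\<exists>(N :: nat) (l :: nat \<Rightarrow> nat). (\<forall>i\<in>{1..N}. 0 < l i) \<and> Gcd (l ` {1..N}) = 1 \<and>
      (\<Sum>i=1..N. p ^ l i) = 1)"
    by blast
next
  assume "0 < p \<and> p < 1 \<and> 0 < r \<and> r < 1 \<and>
    (\<exists>(N :: nat) (l :: nat \<Rightarrow> nat). (\<forall>i\<in>{1..N}. 0 < l i) \<and> Gcd (l ` {1..N}) = 1 \<and>
      (\<Sum>i=1..N. p ^ l i) = 1)"
  then obtain N and l :: "nat \<Rightarrow> nat" where pr: "0 < p" "p < 1" "0 < r" "r < 1"
    and l: "\<forall>i\<in>{1..N}. 0 < l i" "Gcd (l ` {1..N}) = 1" "(\<Sum>i=1..N. p ^ l i) = 1"
    by blast
  have shift: "{1..N} = Suc ` {..<N}" by (simp add: image_Suc_lessThan)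
  \<comment> \<open>An iterated function system has at least two maps: an empty sum is 0, and a
    single positive power of \<open>p\<close> is less than 1.\<close>
  have "N \<noteq> 0" using l(3) by (intro notI) simp
  moreover have "N \<noteq> 1"
  proof
    assume "N = 1"
    with l pr have "p ^ l 1 = 1" "0 < l 1" by auto
    with pr show False using power_less_one_iff[of p "l 1"] by simp
  qed
  ultimately have "2 \<le> N" by linarith
  then show "TDC_OSC1E_roots p r \<noteq> {}"
    using l pr unfolding shift
    by (intro TDC_OSC1E_roots_nonempty[of p r N "\<lambda>i. l (Suc i)"]) (auto simp: image_image sum.reindex)
qed

end
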